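(* Let $f\in\mathbb{R}[X_1,\dots,X_n]$, $h\in\mathbb{R}^n$, and let $g\in\mathscr{C}(h)$ be a feasible solution to the sos program (SLS) with $z\ge f(q)$ for some $q\in\mathbb{Z}^n$. 1. Then $g(\lfloor h\rceil)\le\inf_{x\in\mathbb{Z}^n}f(x)$. 2. If $J$ is fixed, then $y^{(-\infty)}\le y^{(0)}\le y^{(2)}\le y^{(4)}\le\cdots$. 3. If the leading form $f_d$ of $f$ is positive definite, there is $k_0\in\mathbb{N}_0$ such that (SLS) is feasible for all $k\ge k_0$. 4. (SLS) with $k=-\infty$ is (GLOB). 5. If $f-f(h)\in\Sigma$ and $g$ is optimal, then $g(\lfloor h\rceil)\ge f(h)$.
   Context: $\Sigma$ is the set of polynomials in $\mathbb{R}[X_1,\dots,X_n]$ that are finite sums of squares of polynomials in $\mathbb{R}[X_1,\dots,X_n]$. The leading form $f_d$ is the homogeneous component of $f$ of degree $d=\deg f$; it is positive definite if $f_d(x)>0$ for all $x\in\mathbb{R}^n\setminus\{0\}$. $(X-h)^{2\alpha}:=\prod_{j=1}^n(X_j-h_j)^{2\alpha_j}$. $\mathscr{C}(h)$ is the set of all polynomials $\sum_{\alpha\in J}b_\alpha(X-h)^{2\alpha}$ with $J\subset\mathbb{N}_0^n$ finite, $b_\alpha\in\mathbb{R}$, and $b_\alpha\ge0$ for all $\alpha\neq0$. $\lfloor h\rceil\in\mathbb{Z}^n$ is obtained by rounding each component of $h$ to its nearest integer, and $w_\alpha:=(\lfloor h\rceil-h)^{2\alpha}$ is the value of $(X-h)^{2\alpha}$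 at $\lfloor h\rceil$. For given $f$, $h$, $z\in\mathbb{R}$, finite $J\subset\mathbb{N}_0^n$ and a degree bound $k$, (SLS) is the program whose decision variables are the real numbers $b_\alpha$, $\alpha\in J$, and the real coefficients of a polynomial $\sigma\in\mathbb{R}[X_1,\dots,X_n]$: $$y^{(k)}=\max\ \sum_{\alpha\in J}w_\alpha b_\alpha\quad\text{s.t.}\quad f-\sum_{\alpha\in J}b_\alpha(X-h)^{2\alpha}-\sigma\,(z-f)\in\Sigma,\quad b_\alpha\in\Sigma\ \text{(equivalently } b_\alpha\ge0)\text{ for }\alpha\ne0,\quad\sigma\in\Sigma,\quad\deg\sigma\le k.$$ Here $k=-\infty$ corresponds to $\sigma=0$. A solution is identified with the polynomial $g=\sum_{\alpha\in J}b_\alpha(X-h)^{2\alpha}$ it defines; its objective value is $g(\lfloor h\rceil)$. (GLOB), for given $f,h,J$, is the program $$\max\ \sum_{\alpha\in J}w_\alpha b_\alpha\quad\text{s.t.}\quad f-\sum_{\alpha\in J}b_\alpha(X-h)^{2\alpha}\in\Sigma,\quad b_\alpha\in\Sigma\ \text{for }\alpha\neq0$$ in the real decision variables $b_\alpha$, $\alpha\in J$.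
   Formalization: Item 5 is proved under the added assumption 0 ∈ J (a free constant term b_0); without it the claim fails, e.g. n=1, f=X²+1, h=0, J={1}, z=1, k=−∞, where g=0 is optimal but f(h)=1. *)

theory Defs
  imports "HOL-Analysis.Analysis" "HOL-Library.Poly_Mapping"
begin

text \<open>
  Multi-indices are finitely supported maps \<open>'n \<Rightarrow>\<^sub>0 nat\<close>; real polynomials are finitely supported
  coefficient maps on multi-indices, whose ring structure is the convolution product of
  \<^theory>\<open>HOL-Library.Poly_Mapping\<close>.  The variables are indexed by the finite type \<open>'n\<close>.
\<close>

type_synonym 'n mindex = "'n \<Rightarrow>\<^sub>0 nat"
type_synonym 'n rpoly = "'n mindex \<Rightarrow>\<^sub>0 real"

definition pconst :: "real \<Rightarrow> 'n rpoly" where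
  "pconst c = Poly_Mapping.single 0 c"

definition pvar :: "'n \<Rightarrow> 'n rpoly" where
  "pvar j = Poly_Mapping.single (Poly_Mapping.single j 1) 1"

definition peval :: "'n::finite rpoly \<Rightarrow> real ^ 'n \<Rightarrow> real" where
  "peval p x = (\<Sum>\<alpha>\<in>Poly_Mapping.keys p.
     Poly_Mapping.lookup p \<alpha> * (\<Prod>j\<in>UNIV. (x $ j) ^ Poly_Mapping.lookup \<alpha> j))"

definition mindex_deg :: "'n::finite mindex \<Rightarrow> nat" where
  "mindex_deg \<alpha> = (\<Sum>j\<in>UNIV. Poly_Mapping.lookup \<alpha> j)"

text \<open>The zero polynomial has degree \<open>-\<infinity>\<close>, the supremum of the empty set of extended reals.\<close>

definition pdeg :: "'n::finite rpoly \<Rightarrow> ereal" where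
  "pdeg p = (SUP \<alpha>\<in>Poly_Mapping.keys p. ereal (real (mindex_deg \<alpha>)))"

definition hom_component :: "ereal \<Rightarrow> 'n::finite rpoly \<Rightarrow> 'n rpoly" where
  "hom_component d p = (\<Sum>\<alpha> | \<alpha> \<in> Poly_Mapping.keys p \<and> ereal (real (mindex_deg \<alpha>)) = d.
     Poly_Mapping.single \<alpha> (Poly_Mapping.lookup p \<alpha>))"

definition leading_form :: "'n::finite rpoly \<Rightarrow> 'n rpoly" where
  "leading_form p = hom_component (pdeg p) p"

definition positive_definite :: "'n::finite rpoly \<Rightarrow> bool" where
  "positive_definite p \<longleftrightarrow> (\<forall>x. x \<noteq> 0 \<longrightarrow> peval p x > 0)"

definition SOS :: "'n rpoly set" where
  "SOS = {p. \<exists>qs. p = (\<Sum>q\<leftarrow>qs. q ^ 2)}"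

definition int_points :: "(real ^ 'n) set" where
  "int_points = {x. \<forall>j. x $ j \<in> \<int>}"

text \<open>
  Ties are rounded up by \<^const>\<open>round\<close>; the numbers \<open>w \<alpha>\<close> below depend only on the distances
  of the components of \<open>h\<close> to their nearest integers.
\<close>

definition round_vec :: "real ^ 'n \<Rightarrow> real ^ 'n" where
  "round_vec h = (\<chi> j. of_int (round (h $ j)))"

definition shifted_even_monom :: "real ^ 'n::finite \<Rightarrow> 'n mindex \<Rightarrow> 'n rpoly" where
  "shifted_even_monom h \<alpha> =
     (\<Prod>j\<in>UNIV. (pvar j - pconst (h $ j)) ^ (2 * Poly_Mapping.lookup \<alpha> j))"

definition shifted_even_poly ::
    "real ^ 'n::finite \<Rightarrow> 'n mindex set \<Rightarrow> ('n mindex \<Rightarrow> real) \<Rightarrow> 'n rpoly" where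
  "shifted_even_poly h J b = (\<Sum>\<alpha>\<in>J. pconst (b \<alpha>) * shifted_even_monom h \<alpha>)"

definition underestimators :: "real ^ 'n::finite \<Rightarrow> 'n rpoly set" where
  "underestimators h =
     {shifted_even_poly h J b | J b. finite J \<and> (\<forall>\<alpha>\<in>J. \<alpha> \<noteq> 0 \<longrightarrow> b \<alpha> \<ge> 0)}"

definition weight :: "real ^ 'n::finite \<Rightarrow> 'n mindex \<Rightarrow> real" where
  "weight h \<alpha> = (\<Prod>j\<in>UNIV. (round_vec h $ j - h $ j) ^ (2 * Poly_Mapping.lookup \<alpha> j))"

definition objective ::
    "real ^ 'n::finite \<Rightarrow> 'n mindex set \<Rightarrow> ('n mindex \<Rightarrow> real) \<Rightarrow> real" where
  "objective h J b = (\<Sum>\<alpha>\<in>J. weight h \<alpha> * b \<alpha>)"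

text \<open>
  A feasible point of (SLS) is a pair \<open>(b, \<sigma>)\<close>; only the values of \<open>b\<close> on \<open>J\<close> matter.
  The degree bound is an extended real, so that \<open>k = -\<infinity>\<close> forces \<open>\<sigma> = 0\<close>.
\<close>

definition sls_feasible :: "'n::finite rpoly \<Rightarrow> real ^ 'n \<Rightarrow> real \<Rightarrow> 'n mindex set \<Rightarrow> ereal \<Rightarrow>
    (('n mindex \<Rightarrow> real) \<times> 'n rpoly) set" where
  "sls_feasible f h z J k = {(b, \<sigma>).
     f - shifted_even_poly h J b - \<sigma> * (pconst z - f) \<in> SOS \<and>
     (\<forall>\<alpha>\<in>J. \<alpha> \<noteq> 0 \<longrightarrow> pconst (b \<alpha>) \<in> (SOS :: 'n rpoly set)) \<and>
     \<sigma> \<in> SOS \<and> pdeg \<sigma> \<le> k}"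

text \<open>The optimal value as an extended real: \<open>-\<infinity>\<close> for an infeasible program.\<close>

definition sls_value :: "'n::finite rpoly \<Rightarrow> real ^ 'n \<Rightarrow> real \<Rightarrow> 'n mindex set \<Rightarrow> ereal \<Rightarrow> ereal" where
  "sls_value f h z J k = (SUP (b, \<sigma>)\<in>sls_feasible f h z J k. ereal (objective h J b))"

definition sls_feasible_solution ::
    "'n::finite rpoly \<Rightarrow> real ^ 'n \<Rightarrow> real \<Rightarrow> 'n mindex set \<Rightarrow> ereal \<Rightarrow> 'n rpoly \<Rightarrow> bool" where
  "sls_feasible_solution f h z J k g \<longleftrightarrow>
     (\<exists>(b, \<sigma>)\<in>sls_feasible f h z J k. g = shifted_even_poly h J b)"

definition sls_optimal_solution ::
    "'n::finite rpoly \<Rightarrow> real ^ 'n \<Rightarrow> real \<Rightarrow> 'n mindex set \<Rightarrow> ereal \<Rightarrow> 'n rpoly \<Rightarrow> bool" where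
  "sls_optimal_solution f h z J k g \<longleftrightarrow>
     (\<exists>(b, \<sigma>)\<in>sls_feasible f h z J k. g = shifted_even_poly h J b \<and>
        (\<forall>(b', \<sigma>')\<in>sls_feasible f h z J k. objective h J b' \<le> objective h J b))"

definition glob_feasible ::
    "'n::finite rpoly \<Rightarrow> real ^ 'n \<Rightarrow> 'n mindex set \<Rightarrow> ('n mindex \<Rightarrow> real) set" where
  "glob_feasible f h J = {b.
     f - shifted_even_poly h J b \<in> SOS \<and>
     (\<forall>\<alpha>\<in>J. \<alpha> \<noteq> 0 \<longrightarrow> pconst (b \<alpha>) \<in> (SOS :: 'n rpoly set))}"

definition glob_value :: "'n::finite rpoly \<Rightarrow> real ^ 'n \<Rightarrow> 'n mindex set \<Rightarrow> ereal" where
  "glob_value f h J = (SUP b\<in>glob_feasible f h J. ereal (objective h J b))"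

end

theory Submission
  imports Defs
begin

text \<open>
  The only deep part is feasibility under a positive definite leading form.  The bound on the integer
  minimum holds because an even polynomial centred at \<open>h\<close> whose coefficients other than the constant one are
  nonnegative takes its least integer value at the rounding of \<open>h\<close> (\<open>sls_feasible_bound\<close>); monotonicity in
  the degree bound is inclusion of feasible sets; for the bound $-\infty$ the multiplier must vanish; and the last claim compares
  the optimal value with that of the feasible constant $f(h)$.

  For feasibility it suffices to find a real number \<open>b\<close> and a sum of squares $\sigma$ with
  $f - b - \sigma (z - f)$ a sum of squares (\<open>bounded_below_certificate\<close>).  This is a Positivstellensatz for the
  possibly nonconvex compact set $\{f \le z\}$, but the growth of $f$ at infinity allows an elementary proof.
  Put $u = 1 + |X|^2$.  After adding a constant, $f$ becomes a polynomial $p$ with $p \ge \epsilon u^m$ pointwise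
  and degree at most $2m$ (\<open>pd_leading_form_coercive\<close>).  Such a $p$ has a multiplier $\tau$ of degree at most
  $2k$ such that both $\tau - \delta u^k$ and $\tau p - \delta u^{k+m}$ are sums of squares
  (\<open>positive_has_SOS_multiplier\<close>).  After rescaling $\tau$ so that $\sigma = \tau - 1$ is a sum of squares,
  $f - b - \sigma (z - f)$ differs from $\tau p$ only by terms of degree at most $2k$, and
  these are dominated by $u^{k+m}$ and a constant if $m > 0$ (\<open>lower_degree_dominated\<close>); for a constant
  $f$ the choice $b = f$ and $\sigma = 0$ is immediate.

  The multiplier is constructed following Habicht: if $A$ and $B$ are the even and the odd part of $p$ in one
  variable, then $2 A p = p^2 + (A^2 - B^2)$, which reduces $p$ to the polynomials $A$ and $A^2 - B^2$, even in one
  more variable.  A polynomial that is even in every variable is a polynomial in the squares $X_j^2$, positive on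
  the nonnegative orthant, and by Polya's theorem it becomes a nonnegative combination of products of squares
  after multiplication by a power of $u$ (\<open>polya_sampling\<close>).  Polya's theorem itself is proved by comparing
  sampling with and without replacement from a long word.
\<close>

section \<open>Evaluation of polynomials\<close>

definition monom_val :: "'n::finite mindex \<Rightarrow> real ^ 'n \<Rightarrow> real" where
  "monom_val \<alpha> x = (\<Prod>j\<in>UNIV. (x $ j) ^ Poly_Mapping.lookup \<alpha> j)"

lemma monom_val_zero [simp]: "monom_val 0 x = 1"
  by (simp add: monom_val_def)

lemma monom_val_add: "monom_val (\<alpha> + \<beta>) x = monom_val \<alpha> x * monom_val \<beta> x"
  by (simp add: monom_val_def lookup_add power_add prod.distrib)

lemma monom_val_single [simp]: "monom_val (Poly_Mapping.single j n) x = (x $ j) ^ n"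
proof -
  have "monom_val (Poly_Mapping.single j n) x = (\<Prod>i\<in>UNIV. if i = j then (x $ j) ^ n else 1)"
    unfolding monom_val_def by (intro prod.cong) (auto simp: lookup_single when_def)
  then show ?thesis by simp
qed

lemma peval_superset:
  assumes "finite S" "Poly_Mapping.keys p \<subseteq> S"
  shows "peval p x = (\<Sum>\<alpha>\<in>S. Poly_Mapping.lookup p \<alpha> * monom_val \<alpha> x)"
  unfolding peval_def monom_val_def
  by (intro sum.mono_neutral_left) (use assms in \<open>auto simp: in_keys_iff\<close>)

lemma peval_single: "peval (Poly_Mapping.single \<alpha> c) x = c * monom_val \<alpha> x"
  by (subst peval_superset[of "{\<alpha>}"]) auto

lemma peval_add [simp]: "peval (p + q) x = peval p x + peval q x"
proof -
  let ?S = "Poly_Mapping.keys p \<union> Poly_Mapping.keys q"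
  have "Poly_Mapping.keys (p + q) \<subseteq> ?S" by (rule keys_add)
  then show ?thesis
    by (simp add: peval_superset[of ?S] lookup_add algebra_simps sum.distrib)
qed

lemma peval_zero [simp]: "peval 0 x = 0"
  by (simp add: peval_def)

lemma peval_sum [simp]: "peval (\<Sum>i\<in>I. p i) x = (\<Sum>i\<in>I. peval (p i) x)"
  by (induction I rule: infinite_finite_induct) auto

lemma rpoly_expansion:
  "p = (\<Sum>\<alpha>\<in>Poly_Mapping.keys p. Poly_Mapping.single \<alpha> (Poly_Mapping.lookup p \<alpha>))"
  by (rule poly_mapping_eqI) (auto simp: lookup_sum lookup_single when_def in_keys_iff)

lemma peval_mult [simp]: "peval (p * q) x = peval p x * peval q x"
proof -
  let ?P = "Poly_Mapping.keys p" and ?Q = "Poly_Mapping.keys q"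
  have "p * q = (\<Sum>\<alpha>\<in>?P. \<Sum>\<beta>\<in>?Q. Poly_Mapping.single (\<alpha> + \<beta>)
      (Poly_Mapping.lookup p \<alpha> * Poly_Mapping.lookup q \<beta>))"
  proof -
    have "p * q = (\<Sum>\<alpha>\<in>?P. Poly_Mapping.single \<alpha> (Poly_Mapping.lookup p \<alpha>)) *
        (\<Sum>\<beta>\<in>?Q. Poly_Mapping.single \<beta> (Poly_Mapping.lookup q \<beta>))"
      by (simp only: rpoly_expansion[symmetric])
    then show ?thesis by (simp add: sum_product mult_single)
  qed
  then have "peval (p * q) x = (\<Sum>\<alpha>\<in>?P. \<Sum>\<beta>\<in>?Q.
      (Poly_Mapping.lookup p \<alpha> * monom_val \<alpha> x) * (Poly_Mapping.lookup q \<beta> * monom_val \<beta> x))"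
    by (simp add: peval_single monom_val_add algebra_simps)
  also have "\<dots> = peval p x * peval q x"
    by (simp add: sum_product[symmetric] peval_superset[OF finite_keys order_refl])
  finally show ?thesis .
qed

lemma peval_pconst [simp]: "peval (pconst c) x = c"
  by (simp add: pconst_def peval_single)

lemma pconst_1 [simp]: "pconst 1 = 1" and pconst_0 [simp]: "pconst 0 = 0"
  by (simp_all add: pconst_def)

lemma pconst_add: "pconst (a + b) = pconst a + pconst b"
  and pconst_mult: "pconst (a * b) = pconst a * pconst b"
  and pconst_diff: "pconst (a - b) = pconst a - pconst b"
  and pconst_uminus: "pconst (- a) = - pconst a"
  by (simp_all add: pconst_def single_add mult_single single_diff single_uminus)

lemma pconst_2: "pconst 2 * p = p + p"
  by (simp add: pconst_def)

lemma pconst_power: "pconst (a ^ n) = pconst a ^ n"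
  by (induction n) (simp_all add: pconst_mult)

lemma pconst_sum: "pconst (\<Sum>i\<in>I. c i) = (\<Sum>i\<in>I. pconst (c i))"
  by (induction I rule: infinite_finite_induct) (auto simp: pconst_add)

lemma peval_one [simp]: "peval 1 x = 1"
  using peval_pconst[of 1 x] by simp

lemma peval_uminus [simp]: "peval (- p) x = - peval p x"
  using peval_add[of p "- p" x] by simp

lemma peval_diff [simp]: "peval (p - q) x = peval p x - peval q x"
  using peval_add[of "p - q" q x] by simp

lemma peval_power [simp]: "peval (p ^ n) x = peval p x ^ n"
  by (induction n) auto

lemma peval_prod [simp]: "peval (\<Prod>i\<in>I. p i) x = (\<Prod>i\<in>I. peval (p i) x)"
  by (induction I rule: infinite_finite_induct) auto

lemma peval_pvar [simp]: "peval (pvar j) x = x $ j"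
  by (simp add: pvar_def peval_single)

section \<open>The order defined by sums of squares\<close>

text \<open>
  Written as an order, sum-of-squares certificates can be chained and multiplied like inequalities.
\<close>

definition sos_le :: "'n rpoly \<Rightarrow> 'n rpoly \<Rightarrow> bool" (infix "\<preceq>" 50) where
  "p \<preceq> q \<longleftrightarrow> q - p \<in> SOS"

lemma SOS_zero [simp]: "0 \<in> SOS"
  unfolding SOS_def by (auto intro: exI[of _ "[]"])

lemma SOS_power2 [simp]: "q ^ 2 \<in> SOS"
  unfolding SOS_def by (auto intro!: exI[of _ "[q]"])

lemma SOS_add: "p \<in> SOS \<Longrightarrow> q \<in> SOS \<Longrightarrow> p + q \<in> SOS"
  unfolding SOS_def
  by (clarsimp, rename_tac ps qs, rule_tac x = "ps @ qs" in exI) simp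

lemma SOS_sum: "(\<And>i. i \<in> I \<Longrightarrow> p i \<in> SOS) \<Longrightarrow> (\<Sum>i\<in>I. p i) \<in> SOS"
  by (induction I rule: infinite_finite_induct) (auto intro: SOS_add)

lemma SOS_mult:
  assumes "p \<in> SOS" "q \<in> SOS"
  shows "p * q \<in> SOS"
proof -
  obtain ps qs where ps: "p = (\<Sum>r\<leftarrow>ps. r ^ 2)" and qs: "q = (\<Sum>r\<leftarrow>qs. r ^ 2)"
    using assms unfolding SOS_def by blast
  have 1: "a ^ 2 * (\<Sum>r\<leftarrow>qs. r ^ 2) \<in> SOS" for a :: "'a rpoly"
    by (induction qs) (auto simp: distrib_left power_mult_distrib[symmetric] intro!: SOS_add)
  show ?thesis unfolding ps qs
    by (induction ps) (auto simp: distrib_right intro!: SOS_add 1)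
qed

lemma SOS_one [simp]: "1 \<in> SOS"
  using SOS_power2[of 1] by simp

lemma SOS_power: "p \<in> SOS \<Longrightarrow> p ^ n \<in> SOS"
  by (induction n) (auto intro: SOS_mult)

lemma SOS_prod: "(\<And>i. i \<in> I \<Longrightarrow> p i \<in> SOS) \<Longrightarrow> (\<Prod>i\<in>I. p i) \<in> SOS"
  by (induction I rule: infinite_finite_induct) (auto intro: SOS_mult)

lemma SOS_pconst: "c \<ge> 0 \<Longrightarrow> pconst c \<in> SOS"
  using SOS_power2[of "pconst (sqrt c)"] by (simp flip: pconst_power)

lemma SOS_nonneg:
  assumes "p \<in> SOS" shows "peval p x \<ge> 0"
proof -
  obtain ps where ps: "p = (\<Sum>r\<leftarrow>ps. r ^ 2)"
    using assms unfolding SOS_def by blast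
  show ?thesis unfolding ps by (induction ps) auto
qed

lemma pconst_SOS_iff: "pconst c \<in> (SOS :: 'n::finite rpoly set) \<longleftrightarrow> c \<ge> 0"
  using SOS_pconst SOS_nonneg[of "pconst c :: 'n rpoly"] by force

lemma sos_le_refl [simp]: "p \<preceq> p"
  by (simp add: sos_le_def)

lemma sos_le_trans [trans]: "p \<preceq> q \<Longrightarrow> q \<preceq> r \<Longrightarrow> p \<preceq> r"
  unfolding sos_le_def using SOS_add[of "r - q" "q - p"] by simp

lemma sos_le_add: "p \<preceq> q \<Longrightarrow> r \<preceq> s \<Longrightarrow> p + r \<preceq> q + s"
  unfolding sos_le_def using SOS_add[of "q - p" "s - r"] by (simp add: algebra_simps)

lemma sos_le_mult_left: "r \<in> SOS \<Longrightarrow> p \<preceq> q \<Longrightarrow> r * p \<preceq> r * q"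
  unfolding sos_le_def using SOS_mult[of r "q - p"] by (simp add: algebra_simps)

lemma SOS_iff_sos_le: "p \<in> SOS \<longleftrightarrow> 0 \<preceq> p"
  by (simp add: sos_le_def)

lemma sos_le_mult:
  assumes "0 \<preceq> p" "p \<preceq> q" "0 \<preceq> r" "r \<preceq> s"
  shows "p * r \<preceq> q * s"
proof -
  have "p * r \<preceq> p * s"
    using assms by (intro sos_le_mult_left) (auto simp: SOS_iff_sos_le)
  also have "p * s \<preceq> q * s"
    using sos_le_mult_left[of s p q] assms sos_le_trans by (auto simp: SOS_iff_sos_le mult.commute)
  finally show ?thesis .
qed

lemma sos_le_power: "0 \<preceq> p \<Longrightarrow> p \<preceq> q \<Longrightarrow> p ^ n \<preceq> q ^ n"
  by (induction n) (auto intro!: sos_le_mult simp: SOS_iff_sos_le[symmetric] SOS_power)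

lemma pconst_mult_SOS: "c \<ge> 0 \<Longrightarrow> p \<in> SOS \<Longrightarrow> pconst c * p \<in> SOS"
  by (intro SOS_mult SOS_pconst)

lemma sos_le_pconst_mono: "c \<le> d \<Longrightarrow> p \<in> SOS \<Longrightarrow> pconst c * p \<preceq> pconst d * p"
  unfolding sos_le_def using pconst_mult_SOS[of "d - c" p] by (simp add: pconst_diff algebra_simps)

section \<open>Degree bounds\<close>

text \<open>
  A bound instead of the degree itself: cancellation of leading terms never matters below, and the
  zero polynomial needs no special treatment.
\<close>

definition deg_le :: "'n::finite rpoly \<Rightarrow> nat \<Rightarrow> bool" where
  "deg_le p d \<longleftrightarrow> (\<forall>\<alpha>\<in>Poly_Mapping.keys p. mindex_deg \<alpha> \<le> d)"

lemma mindex_deg_add: "mindex_deg (\<alpha> + \<beta>) = mindex_deg \<alpha> + mindex_deg \<beta>"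
  by (simp add: mindex_deg_def lookup_add sum.distrib)

lemma mindex_deg_single [simp]: "mindex_deg (Poly_Mapping.single j n) = n"
proof -
  have "mindex_deg (Poly_Mapping.single j n) = (\<Sum>i\<in>UNIV. if i = j then n else 0)"
    unfolding mindex_deg_def by (intro sum.cong) (auto simp: lookup_single when_def)
  then show ?thesis by simp
qed

lemma mindex_deg_zero [simp]: "mindex_deg 0 = 0"
  by (simp add: mindex_deg_def)

lemma mindex_deg_eq_0_iff: "mindex_deg \<alpha> = 0 \<longleftrightarrow> \<alpha> = 0"
  by (auto simp: mindex_deg_def intro: poly_mapping_eqI)

lemma deg_le_mono: "deg_le p d \<Longrightarrow> d \<le> e \<Longrightarrow> deg_le p e"
  unfolding deg_le_def by force

lemma deg_le_add: "deg_le p d \<Longrightarrow> deg_le q d \<Longrightarrow> deg_le (p + q) d"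
  unfolding deg_le_def using keys_add[of p q] by blast

lemma deg_le_mult:
  assumes "deg_le p d" "deg_le q e"
  shows "deg_le (p * q) (d + e)"
proof -
  have "mindex_deg (\<alpha> + \<beta>) \<le> d + e" if "\<alpha> \<in> Poly_Mapping.keys p" "\<beta> \<in> Poly_Mapping.keys q" for \<alpha> \<beta>
    using that assms by (simp add: deg_le_def mindex_deg_add add_mono)
  then show ?thesis unfolding deg_le_def using keys_mult[of p q] by blast
qed

lemma deg_le_zero [simp]: "deg_le 0 d"
  by (simp add: deg_le_def)

lemma deg_le_pconst [simp]: "deg_le (pconst c) d"
  by (simp add: deg_le_def pconst_def)

lemma deg_le_one [simp]: "deg_le 1 d"
  using deg_le_pconst[of 1 d] by simp

lemma deg_le_uminus: "deg_le p d \<Longrightarrow> deg_le (- p) d"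
  by (simp add: deg_le_def keys_def)

lemma deg_le_diff: "deg_le p d \<Longrightarrow> deg_le q d \<Longrightarrow> deg_le (p - q) d"
  using deg_le_add[of p d "- q"] deg_le_uminus[of q d] by simp

lemma deg_le_power: "deg_le p d \<Longrightarrow> deg_le (p ^ k) (k * d)"
  by (induction k) (auto intro: deg_le_mult)

lemma deg_le_sum: "(\<And>i. i \<in> I \<Longrightarrow> deg_le (p i) d) \<Longrightarrow> deg_le (\<Sum>i\<in>I. p i) d"
  by (induction I rule: infinite_finite_induct) (auto intro: deg_le_add)

lemma deg_le_pvar: "deg_le (pvar j) 1"
  by (simp add: deg_le_def pvar_def)

lemma pdeg_le_iff: "pdeg p \<le> ereal (real d) \<longleftrightarrow> deg_le p d"
  by (auto simp: pdeg_def deg_le_def SUP_le_iff)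

lemma ex_deg_le: "\<exists>d. deg_le p d"
proof -
  have "\<forall>\<alpha>\<in>Poly_Mapping.keys p. mindex_deg \<alpha> \<le> (\<Sum>\<alpha>\<in>Poly_Mapping.keys p. mindex_deg \<alpha>)"
    by (auto intro: member_le_sum)
  then show ?thesis unfolding deg_le_def by blast
qed

lemma pdeg_le_MInf_iff: "pdeg p \<le> -\<infinity> \<longleftrightarrow> p = 0"
proof
  assume "pdeg p \<le> -\<infinity>"
  then have "\<forall>\<alpha>\<in>Poly_Mapping.keys p. ereal (real (mindex_deg \<alpha>)) \<le> -\<infinity>"
    unfolding pdeg_def by (simp only: SUP_le_iff)
  then show "p = 0" by simp
qed (simp add: pdeg_def bot_ereal_def)

lemma mindex_pop:
  assumes "\<alpha> \<noteq> (0 :: 'n::finite mindex)"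
  obtains j \<beta> where "\<alpha> = \<beta> + Poly_Mapping.single j 1"
proof -
  obtain j where j: "Poly_Mapping.lookup \<alpha> j \<noteq> 0"
    using assms by (metis lookup_zero poly_mapping_eqI)
  have "\<alpha> = (\<alpha> - Poly_Mapping.single j 1) + Poly_Mapping.single j 1"
    using j by (intro poly_mapping_eqI) (auto simp: lookup_add lookup_minus lookup_single when_def)
  then show ?thesis by (rule that)
qed

text \<open>
  Used with \<open>a = Suc k\<close> and \<open>b = k\<close>: a monomial of degree at most $2k + 1$ is a product of two factors of
  about half the degree, to which the inequality between arithmetic and geometric means applies.
\<close>

lemma mindex_split:
  fixes \<alpha> :: "'n::finite mindex"
  shows "mindex_deg \<alpha> \<le> a + b \<Longrightarrow> \<exists>\<beta> \<gamma>. \<alpha> = \<beta> + \<gamma> \<and> mindex_deg \<beta> \<le> a \<and> mindex_deg \<gamma> \<le> b"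
proof (induction a arbitrary: \<alpha>)
  case 0
  then show ?case by (intro exI[of _ 0] exI[of _ \<alpha>]) auto
next
  case (Suc a)
  show ?case
  proof (cases "\<alpha> = 0")
    case False
    then obtain j \<alpha>' where \<alpha>: "\<alpha> = \<alpha>' + Poly_Mapping.single j 1" by (rule mindex_pop)
    then have "mindex_deg \<alpha>' \<le> a + b" using Suc.prems by (simp add: mindex_deg_add)
    from Suc.IH[OF this] obtain \<beta> \<gamma> where
      "\<alpha>' = \<beta> + \<gamma>" "mindex_deg \<beta> \<le> a" "mindex_deg \<gamma> \<le> b" by blast
    then show ?thesis
      by (intro exI[of _ "\<beta> + Poly_Mapping.single j 1"] exI[of _ \<gamma>])
        (auto simp: \<alpha> mindex_deg_add algebra_simps)
  qed (auto intro!: exI[of _ 0])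
qed

abbreviation monom :: "'n mindex \<Rightarrow> 'n rpoly" where
  "monom \<alpha> \<equiv> Poly_Mapping.single \<alpha> 1"

lemma monom_add: "monom (\<alpha> + \<beta>) = monom \<alpha> * monom \<beta>"
  by (simp add: mult_single)

lemma pconst_monom: "pconst c * monom \<alpha> = Poly_Mapping.single \<alpha> c"
  by (simp add: pconst_def mult_single)

lemma rpoly_monom_expansion: "p = (\<Sum>\<alpha>\<in>Poly_Mapping.keys p. pconst (Poly_Mapping.lookup p \<alpha>) * monom \<alpha>)"
  unfolding pconst_monom by (rule rpoly_expansion)

section \<open>Domination by powers of $1 + |X|^2$\<close>

text \<open>
  The polynomial $1 + |X|^2$.  Its powers are the yardstick for positivity: \<open>usq ^ k\<close> is a sum of
  squares of degree \<open>2 * k\<close> that bounds every polynomial of lower degree up to a constant, and bounding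
  a polynomial below by a multiple of it controls the polynomial on all of $\mathbb{R}^n$ and at
  infinity simultaneously, so that no homogenization is needed.
\<close>

definition usq :: "'n::finite rpoly" where
  "usq = 1 + (\<Sum>j\<in>UNIV. pvar j ^ 2)"

lemma peval_usq: "peval usq x = 1 + (norm x)\<^sup>2"
  by (simp add: usq_def norm_vec_def L2_set_def sum_nonneg)

lemma deg_le_usq_power: "deg_le (usq ^ k) (2 * k)"
proof -
  have "deg_le (usq :: 'a rpoly) 2" unfolding usq_def
    using deg_le_power[OF deg_le_pvar, of _ 2]
    by (intro deg_le_add deg_le_sum) auto
  from deg_le_power[OF this, of k] show ?thesis by (simp add: mult.commute)
qed

lemma one_le_usq: "1 \<preceq> usq"
  unfolding sos_le_def usq_def by (auto intro: SOS_sum)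

lemma usq_SOS [simp]: "usq ^ k \<in> SOS"
  by (intro SOS_power) (auto simp: usq_def intro!: SOS_add SOS_sum)

lemma pvar_sq_le_usq: "pvar j ^ 2 \<preceq> usq"
proof -
  have "usq = 1 + pvar j ^ 2 + (\<Sum>i\<in>UNIV - {j}. pvar i ^ 2)"
    unfolding usq_def by (simp add: sum.remove[of UNIV j])
  then have "usq - pvar j ^ 2 = 1 + (\<Sum>i\<in>UNIV - {j}. pvar i ^ 2)" by (simp add: algebra_simps)
  then show ?thesis unfolding sos_le_def by (auto intro!: SOS_add SOS_sum)
qed

lemma usq_power_mono: "k \<le> l \<Longrightarrow> usq ^ k \<preceq> usq ^ l"
proof -
  assume "k \<le> l"
  have "usq ^ k * 1 ^ (l - k) \<preceq> usq ^ k * usq ^ (l - k)"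
    by (intro sos_le_mult_left sos_le_power one_le_usq usq_SOS) (simp add: SOS_iff_sos_le[symmetric])
  then show ?thesis using \<open>k \<le> l\<close> by (simp flip: power_add)
qed

lemma monom_sq_le_usq: "mindex_deg \<alpha> \<le> k \<Longrightarrow> monom \<alpha> ^ 2 \<preceq> usq ^ k"
proof (induction k arbitrary: \<alpha>)
  case 0
  then show ?case by (simp add: mindex_deg_eq_0_iff)
next
  case (Suc k)
  show ?case
  proof (cases "\<alpha> = 0")
    case False
    then obtain j \<alpha>' where \<alpha>: "\<alpha> = \<alpha>' + Poly_Mapping.single j 1" by (rule mindex_pop)
    then have "monom \<alpha>' ^ 2 \<preceq> usq ^ k"
      using Suc by (simp add: mindex_deg_add)
    then have "pvar j ^ 2 * monom \<alpha>' ^ 2 \<preceq> usq * usq ^ k"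
      by (intro sos_le_mult pvar_sq_le_usq) (simp_all flip: SOS_iff_sos_le)
    then show ?thesis by (simp add: \<alpha> monom_add power_mult_distrib pvar_def mult.commute)
  qed (use usq_power_mono[of 0 "Suc k"] in simp)
qed

text \<open>
  For a sum of squares $u$ one has
  $u^{k+1} \le \eta u^{k+2} + u^k / (4 \eta)$, because the difference is $u^k$ times the square of
  $\sqrt\eta\, u - 1 / (2 \sqrt\eta)$.  Bounding $u^k$ by induction with the coefficient $2 \eta$ returns
  half of $u^{k+1}$ on the right, which is absorbed on the left.
\<close>

lemma usq_power_dominated:
  "\<delta> > 0 \<Longrightarrow> \<exists>C. (usq :: 'n::finite rpoly) ^ k \<preceq> pconst \<delta> * usq ^ Suc k + pconst C"
proof (induction k arbitrary: \<delta>)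
  case 0
  have "(usq :: 'n rpoly) ^ 0 \<preceq> pconst \<delta> * usq ^ Suc 0 + pconst 1"
    using 0 by (auto simp: sos_le_def intro!: pconst_mult_SOS usq_SOS[of 1, simplified])
  then show ?case by blast
next
  case (Suc k)
  define \<eta> where "\<eta> = \<delta> / 2"
  have \<eta>: "\<eta> > 0" "2 * \<eta> > 0" "\<delta> = 2 * \<eta>" using Suc.prems by (auto simp: \<eta>_def)
  from Suc.IH[OF \<eta>(2)] obtain C
    where C: "(usq :: 'n rpoly) ^ k \<preceq> pconst (2 * \<eta>) * usq ^ Suc k + pconst C" by blast
  define s :: real where "s = sqrt \<eta>"
  have s: "s > 0" "\<eta> = s * s" using \<eta> by (auto simp: s_def)
  have "(usq :: 'n rpoly) ^ Suc k \<preceq> pconst \<eta> * usq ^ Suc (Suc k) + pconst (1/(4 * \<eta>)) * usq ^ k"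
  proof -
    have e: "pconst \<eta> * u * u + pconst (1/(4 * \<eta>)) - u = (pconst s * u - pconst (1/(2 * s))) ^ 2"
      for u :: "'n rpoly"
    proof -
      have 1: "pconst s * pconst (1/(2 * s)) = (pconst (1/2) :: 'n rpoly)"
         "pconst (1/(4 * \<eta>)) = (pconst (1/(2 * s)) * pconst (1/(2 * s)) :: 'n rpoly)"
        "pconst \<eta> = (pconst s * pconst s :: 'n rpoly)"
        using s by (simp_all flip: pconst_mult)
      have 2: "2 * pconst (1/2) = (1::'n rpoly)"
        using pconst_add[of "1/2" "1/2"] by (simp flip: mult_2)
      have "(pconst s * u - pconst (1/(2 * s))) ^ 2 = pconst s * pconst s * u * u
          + pconst (1/(2 * s)) * pconst (1/(2 * s)) - 2 * (pconst s * pconst (1/(2 * s))) * u"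
        by (simp add: power2_eq_square algebra_simps)
      then show ?thesis unfolding 1 2 by simp
    qed
    have "usq ^ k * (pconst s * usq - pconst (1/(2 * s))) ^ 2 \<in> (SOS :: 'n rpoly set)"
      by (intro SOS_mult) auto
    then show ?thesis unfolding sos_le_def e[symmetric] by (simp add: algebra_simps)
  qed
  also have "\<dots> \<preceq> pconst \<eta> * usq ^ Suc (Suc k) +
      pconst (1/(4 * \<eta>)) * (pconst (2 * \<eta>) * usq ^ Suc k + pconst C)"
    using \<eta> by (intro sos_le_add sos_le_mult_left C SOS_pconst) auto
  finally have "pconst 2 * usq ^ Suc k \<preceq> pconst 2 * (pconst \<eta> * usq ^ Suc (Suc k) +
      pconst (1/(4 * \<eta>)) * (pconst (2 * \<eta>) * usq ^ Suc k + pconst C :: 'n rpoly))"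
    by (intro sos_le_mult_left SOS_pconst) auto
  also have "\<dots> = pconst \<delta> * usq ^ Suc (Suc k) + usq ^ Suc k + pconst (C / (2 * \<eta>))"
    using \<eta> by (simp only: distrib_left mult.assoc[symmetric] pconst_mult[symmetric]) simp
  finally have "(usq :: 'n rpoly) ^ Suc k \<preceq> pconst \<delta> * usq ^ Suc (Suc k) + pconst (C / (2 * \<eta>) :: real)"
    unfolding sos_le_def pconst_2 by (simp add: algebra_simps)
  then show ?case by blast
qed

text \<open>
  Split $X^\alpha = X^\beta X^\gamma$ with $|\beta| \le k + 1$ and $|\gamma| \le k$.  Completing the
  square bounds the product by a small multiple of $X^{2\beta}$, hence of $u^{k+1}$, and a large multiple
  of $X^{2\gamma}$, hence of $u^k$; the latter is absorbed by a small multiple of $u^{k+1}$ and a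
  constant.
\<close>

lemma monom_dominated:
  fixes \<alpha> :: "'n::finite mindex"
  assumes deg: "mindex_deg \<alpha> \<le> 2 * k + 1" and dpos: "\<delta> > 0"
  shows "\<exists>C. pconst c * monom \<alpha> \<preceq> pconst \<delta> * (usq :: 'n rpoly) ^ Suc k + pconst C"
proof -
  obtain \<beta> \<gamma> where \<beta>\<gamma>: "\<alpha> = \<beta> + \<gamma>" "mindex_deg \<beta> \<le> Suc k" "mindex_deg \<gamma> \<le> k"
    using mindex_split[of \<alpha> "Suc k" k] deg by (auto simp: mult_2)
  define s where "s = sqrt (\<delta> / 2)"
  have s: "s > 0" "s * s = \<delta> / 2" using dpos by (auto simp: s_def)
  \<comment> \<open>The added 1 keeps the divisor positive when c = 0.\<close>
  define D where "D = (c/(2 * s))^2 + 1"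
  have D: "D > 0" unfolding D_def by (intro add_nonneg_pos) auto
  have "\<delta> / 2 / D > 0" using D dpos by simp
  from usq_power_dominated[OF this, of k] obtain C
    where C: "(usq :: 'n rpoly) ^ k \<preceq> pconst (\<delta> / 2 / D) * usq ^ Suc k + pconst C" by blast
  have "pconst c * monom \<alpha> \<preceq> pconst (\<delta>/2) * monom \<beta> ^ 2 + pconst ((c/(2 * s))^2) * monom \<gamma> ^ 2"
  proof -
    have 1: "pconst s * pconst s = (pconst (\<delta>/2) :: 'n rpoly)"
      by (simp only: s(2) pconst_mult[symmetric])
    have 2: "pconst s * pconst (c/(2 * s)) = (pconst (c/2) :: 'n rpoly)"
      using s by (simp flip: pconst_mult)
    have 3: "pconst (c/2) + pconst (c/2) = (pconst c :: 'n rpoly)"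
      by (simp flip: pconst_add)
    have "(pconst s * monom \<beta> - pconst (c/(2 * s)) * monom \<gamma>) ^ 2 =
      pconst s * pconst s * monom \<beta> ^ 2 + pconst ((c/(2 * s))^2) * monom \<gamma> ^ 2
       - (pconst s * pconst (c/(2 * s)) + pconst s * pconst (c/(2 * s))) * (monom \<beta> * monom \<gamma>)"
      unfolding pconst_power by (simp add: power2_eq_square algebra_simps)
    then have "(pconst s * monom \<beta> - pconst (c/(2 * s)) * monom \<gamma>) ^ 2 =
      pconst (\<delta>/2) * monom \<beta> ^ 2 + pconst ((c/(2 * s))^2) * monom \<gamma> ^ 2 - pconst c * monom \<alpha>"
      unfolding 1 2 3 \<beta>\<gamma>(1) monom_add .
    then show ?thesis unfolding sos_le_def by (metis SOS_power2)
  qed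
  also have "\<dots> \<preceq> pconst (\<delta>/2) * usq ^ Suc k + pconst ((c/(2 * s))^2) * usq ^ k"
    using dpos by (intro sos_le_add sos_le_mult_left monom_sq_le_usq \<beta>\<gamma> SOS_pconst) auto
  also have "\<dots> \<preceq> pconst (\<delta>/2) * usq ^ Suc k + pconst D * usq ^ k"
    using dpos by (intro sos_le_add sos_le_pconst_mono) (auto simp: D_def simp del: power_Suc)
  also have "\<dots> \<preceq> pconst (\<delta>/2) * usq ^ Suc k + pconst D *
      (pconst (\<delta> / 2 / D) * usq ^ Suc k + pconst C)"
    using D dpos by (intro sos_le_add sos_le_mult_left C SOS_pconst) auto
  also have "\<dots> = pconst \<delta> * usq ^ Suc k + pconst (D * C)"
  proof -
    have "D * (\<delta> / 2 / D) = \<delta> / 2"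
      using D by simp
    moreover have "pconst (\<delta>/2) * r + (pconst (\<delta>/2) * r + t) = pconst \<delta> * r + t" for r t :: "'n rpoly"
      by (simp flip: pconst_add distrib_right add.assoc)
    ultimately show ?thesis
      by (simp only: distrib_left mult.assoc[symmetric] pconst_mult[symmetric])
  qed
  finally show ?thesis by blast
qed

text \<open>
  A term of degree strictly below that of \<open>usq ^ Suc k\<close> is harmless: this is what allows the terms
  without a sign in the certificate for the program to be compensated by lowering a constant.
\<close>

lemma lower_degree_dominated:
  fixes r :: "'n::finite rpoly"
  assumes "deg_le r (2 * k + 1)" "\<delta> > 0"
  shows "\<exists>C. r \<preceq> pconst \<delta> * usq ^ Suc k + pconst C"
proof -
  define K where "K = Poly_Mapping.keys r"
  have "\<forall>\<alpha>\<in>K. \<exists>C. pconst (Poly_Mapping.lookup r \<alpha>) * monom \<alpha> \<preceq>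
       pconst (\<delta> / (card K + 1)) * (usq :: 'n rpoly) ^ Suc k + pconst C"
    using assms by (intro ballI monom_dominated) (auto simp: deg_le_def K_def)
  then obtain C where C: "\<And>\<alpha>. \<alpha> \<in> K \<Longrightarrow> pconst (Poly_Mapping.lookup r \<alpha>) * monom \<alpha> \<preceq>
       pconst (\<delta> / (card K + 1)) * (usq :: 'n rpoly) ^ Suc k + pconst (C \<alpha>)"
    by metis
  have "r = (\<Sum>\<alpha>\<in>K. pconst (Poly_Mapping.lookup r \<alpha>) * monom \<alpha>)"
    unfolding K_def by (rule rpoly_monom_expansion)
  also have "\<dots> \<preceq> (\<Sum>\<alpha>\<in>K. pconst (\<delta> / (card K + 1)) * (usq :: 'n rpoly) ^ Suc k + pconst (C \<alpha>))"
    using C unfolding sos_le_def by (simp only: sum_subtractf[symmetric]) (rule SOS_sum)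
  also have "\<dots> = pconst (\<Sum>\<alpha>\<in>K. \<delta> / (card K + 1)) * usq ^ Suc k + pconst (\<Sum>\<alpha>\<in>K. C \<alpha>)"
    by (simp only: sum.distrib pconst_sum sum_distrib_right)
  also have "\<dots> \<preceq> pconst \<delta> * usq ^ Suc k + pconst (\<Sum>\<alpha>\<in>K. C \<alpha>)"
    using \<open>\<delta> > 0\<close> by (intro sos_le_add sos_le_pconst_mono) (auto simp: field_simps simp del: power_Suc)
  finally show ?thesis by blast
qed

section \<open>Polya's theorem by sampling\<close>

text \<open>
  Expanding a power of $\sum_a y_a$ gives a sum over words of length $M$.  A monomial of degree $m$
  times the power for the remaining $M - m$ positions is the sum over the words with prescribed letters
  at $m$ chosen positions, whichever distinct positions $\iota(0), \dots, \iota(m-1)$ are chosen.  This freedom is what is averaged over in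
  the proof of Polya's theorem.
\<close>

lemma prod_mult_power_eq_sum_words:
  fixes y :: "'a::finite \<Rightarrow> 'r::comm_ring_1" and v :: "nat \<Rightarrow> 'a"
  assumes inj: "inj_on \<iota> {..<m}" and \<iota>: "\<iota> \<in> {..<m} \<rightarrow> {..<M}"
  shows "(\<Prod>k<m. y (v k)) * (\<Sum>a\<in>UNIV. y a) ^ (M - m) =
    (\<Sum>w\<in>{..<M} \<rightarrow>\<^sub>E UNIV. of_bool (\<forall>k<m. w (\<iota> k) = v k) * (\<Prod>i<M. y (w i)))"
proof -
  define S where "S = \<iota> ` {..<m}"
  \<comment> \<open>The constraint on the letter a at position i; it is vacuous outside the chosen positions.\<close>
  define e where "e i a = (i \<in> S \<longrightarrow> a = v (inv_into {..<m} \<iota> i))" for i a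
  have S: "S \<subseteq> {..<M}" "card S = m"
    using inj \<iota> by (auto simp: S_def card_image)
  have "(\<Prod>i<M. \<Sum>a\<in>UNIV. of_bool (e i a) * y a) =
      (\<Prod>i\<in>S. \<Sum>a\<in>UNIV. of_bool (e i a) * y a) * (\<Prod>i\<in>{..<M} - S. \<Sum>a\<in>UNIV. of_bool (e i a) * y a)"
    by (subst prod.subset_diff[OF S(1)]) (simp_all only: finite_lessThan mult.commute)
  also have "(\<Prod>i\<in>{..<M} - S. \<Sum>a\<in>UNIV. of_bool (e i a) * y a) = (\<Sum>a\<in>UNIV. y a) ^ (M - m)"
    using S by (simp add: e_def card_Diff_subset finite_subset)
  also have "(\<Prod>i\<in>S. \<Sum>a\<in>UNIV. of_bool (e i a) * y a) = (\<Prod>i\<in>S. y (v (inv_into {..<m} \<iota> i)))"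
    by (intro prod.cong) (simp_all add: e_def)
  also have "\<dots> = (\<Prod>k<m. y (v k))"
    unfolding S_def using inj by (simp add: prod.reindex)
  finally have "(\<Prod>k<m. y (v k)) * (\<Sum>a\<in>UNIV. y a) ^ (M - m) =
      (\<Prod>i<M. \<Sum>a\<in>UNIV. of_bool (e i a) * y a)"
    by (rule sym)
  also have "\<dots> = (\<Sum>w\<in>{..<M} \<rightarrow>\<^sub>E UNIV. \<Prod>i<M. of_bool (e i (w i)) * y (w i))"
    by (rule prod_sum_PiE) auto
  also have "\<dots> = (\<Sum>w\<in>{..<M} \<rightarrow>\<^sub>E UNIV. of_bool (\<forall>k<m. w (\<iota> k) = v k) * (\<Prod>i<M. y (w i)))"
  proof (intro sum.cong refl)
    fix w :: "nat \<Rightarrow> 'a"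
    have *: "(\<Prod>i<M. of_bool (e i (w i))) = (of_bool (\<forall>i<M. e i (w i)) :: 'r)"
      by (induction M) (auto simp: less_Suc_eq)
    have "(\<forall>i<M. e i (w i)) \<longleftrightarrow> (\<forall>k<m. w (\<iota> k) = v k)"
      using inj \<iota> by (auto simp: e_def S_def)
    with * show "(\<Prod>i<M. of_bool (e i (w i)) * y (w i)) =
        of_bool (\<forall>k<m. w (\<iota> k) = v k) * (\<Prod>i<M. y (w i))"
      by (simp add: prod.distrib)
  qed
  finally show ?thesis .
qed

text \<open>
  Sampling a fixed number of positions with replacement rarely repeats one in a long word.
\<close>

lemma injection_ratio_tendsto:
  "(\<lambda>M. real (card {\<iota> \<in> {..<m} \<rightarrow>\<^sub>E {..<M}. inj_on \<iota> {..<m}}) / real M ^ m) \<longlonglongrightarrow> 1"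
proof -
  have "(\<lambda>M. \<Prod>i<m. 1 - real i / real M) \<longlonglongrightarrow> (\<Prod>i<m. 1 - 0)"
    by (intro tendsto_intros lim_const_over_n)
  moreover have "eventually (\<lambda>M. (\<Prod>i<m. 1 - real i / real M) =
      real (card {\<iota> \<in> {..<m} \<rightarrow>\<^sub>E {..<M}. inj_on \<iota> {..<m}}) / real M ^ m) sequentially"
    using eventually_ge_at_top[of "Suc m"]
  proof eventually_elim
    case (elim M)
    have "card {\<iota> \<in> {..<m} \<rightarrow>\<^sub>E {..<M}. inj_on \<iota> {..<m}} = (\<Prod>i<m. M - i)"
      using card_inj_on_subset_funcset[of "{..<m}" "{..<M}" "{..<m}"] by (simp add: atLeast0LessThan)
    then have "real (card {\<iota> \<in> {..<m} \<rightarrow>\<^sub>E {..<M}. inj_on \<iota> {..<m}}) = (\<Prod>i<m. real M - real i)"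
      using elim by (simp add: of_nat_diff)
    also have "\<dots> = (\<Prod>i<m. real M * (1 - real i / real M))"
      using elim by (intro prod.cong) (auto simp: field_simps)
    also have "\<dots> = real M ^ m * (\<Prod>i<m. 1 - real i / real M)"
      by (simp add: prod.distrib)
    finally show ?case using elim by simp
  qed
  ultimately show ?thesis by (simp add: filterlim_cong)
qed

text \<open>
  Polya's theorem: a form $q(y) = \sum_t c_t \prod_{k<m} y_{v_t(k)}$ that is positive on the simplex
  gets nonnegative coefficients after multiplication by a high power of $\sum_a y_a$.  Positivity is
  assumed in homogeneous form and at integer points only, the letter counts of words.
  
  Average the word expansion over all injections $\iota$ of the $m$ factors into the $M$ positions.
  The coefficient of a word $w$ becomes $\sum_t c_t$ times the number of injections with
  $w \circ \iota = v_t$.  Were all maps $\iota$ counted, this would be the value of $q$ at the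
  vector of letter counts of $w$, which is at least $\delta M^m$ since the counts sum to $M$; and
  for large $M$ the maps that are not injective are too small a fraction of all $M^m$ to make the
  coefficient negative.
\<close>

lemma polya_sampling:
  fixes y :: "'a::finite \<Rightarrow> 'n::finite rpoly" and c :: "'t \<Rightarrow> real" and v :: "'t \<Rightarrow> nat \<Rightarrow> 'a"
  assumes y: "\<And>a. y a \<in> SOS" and "finite T" "\<delta> > 0"
    and pos: "\<And>\<tau> :: 'a \<Rightarrow> nat.
      (\<Sum>t\<in>T. c t * (\<Prod>k<m. real (\<tau> (v t k)))) \<ge> \<delta> * (\<Sum>a\<in>UNIV. real (\<tau> a)) ^ m"
  shows "\<exists>N. (\<Sum>t\<in>T. pconst (c t) * (\<Prod>k<m. y (v t k))) * (\<Sum>a\<in>UNIV. y a) ^ N \<in> SOS"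
proof -
  define C where "C = (\<Sum>t\<in>T. \<bar>c t\<bar>)"
  define F :: "nat \<Rightarrow> (nat \<Rightarrow> nat) set" where "F M = {..<m} \<rightarrow>\<^sub>E {..<M}" for M
  define I where "I M = {\<iota> \<in> F M. inj_on \<iota> {..<m}}" for M
  have finF: "finite (F M)" and cardF: "card (F M) = M ^ m" for M
    unfolding F_def by (auto intro: finite_PiE simp: card_funcsetE)
  have IF: "I M \<subseteq> F M" for M by (auto simp: I_def)
  obtain M where M: "M > 0" "C * (1 - card (I M) / real M ^ m) \<le> \<delta>" "card (I M) > 0"
  proof -
    have lim: "(\<lambda>M. card (I M) / real M ^ m) \<longlonglongrightarrow> 1"
      using injection_ratio_tendsto[of m] by (simp add: I_def F_def)
    then have "(\<lambda>M. C * (1 - card (I M) / real M ^ m)) \<longlonglongrightarrow> C * (1 - 1)"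
      by (intro tendsto_intros)
    then have "eventually (\<lambda>M. C * (1 - card (I M) / real M ^ m) < \<delta>) sequentially"
      using \<open>\<delta> > 0\<close> by (intro order_tendstoD) auto
    moreover have "eventually (\<lambda>M. card (I M) / real M ^ m > 0) sequentially"
      using lim by (rule order_tendstoD) auto
    ultimately have "eventually (\<lambda>M. M > 0 \<and> C * (1 - card (I M) / real M ^ m) \<le> \<delta> \<and> card (I M) > 0) sequentially"
      using eventually_gt_at_top[of 0]
      by eventually_elim (auto simp: zero_less_divide_iff intro: Nat.gr0I)
    then show ?thesis using that by (auto simp: eventually_sequentially)
  qed
  \<comment> \<open>The total contribution of the maps that are not injective.\<close>
  have bad: "C * card (F M - I M) \<le> \<delta> * real M ^ m"
  proof -
    have "real (card (F M - I M)) = real M ^ m - card (I M)"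
      using card_Diff_subset[OF finite_subset[OF IF finF] IF, of M] card_mono[OF finF IF, of M] cardF
      by (simp add: of_nat_diff)
    also have "\<dots> = (1 - card (I M) / real M ^ m) * real M ^ m"
      using M by (simp add: left_diff_distrib)
    finally have "C * card (F M - I M) = C * (1 - card (I M) / real M ^ m) * real M ^ m"
      by simp
    also have "\<dots> \<le> \<delta> * real M ^ m" by (intro mult_right_mono M) simp
    finally show ?thesis .
  qed
  define W where "W = ({..<M} \<rightarrow>\<^sub>E UNIV :: (nat \<Rightarrow> 'a) set)"
  define H where "H w t = {\<iota> :: nat \<Rightarrow> nat. \<forall>k<m. w (\<iota> k) = v t k}" for w t
  define K where "K w = (\<Sum>t\<in>T. c t * real (card (I M \<inter> H w t)))" for w
  \<comment> \<open>The coefficient of the word w is nonnegative.\<close>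
  have K: "K w \<ge> 0" for w
  proof -
    define \<tau> where "\<tau> a = card {i\<in>{..<M}. w i = a}" for a
    have cardFH: "(\<Prod>k<m. real (\<tau> (v t k))) = real (card (F M \<inter> H w t))" for t
    proof -
      have "F M \<inter> H w t = PiE {..<m} (\<lambda>k. {i\<in>{..<M}. w i = v t k})"
        by (auto simp: F_def H_def PiE_iff)
      then show ?thesis by (simp add: card_PiE \<tau>_def)
    qed
    have "(\<Sum>a\<in>UNIV. \<tau> a) = card (\<Union>a. {i\<in>{..<M}. w i = a})"
      unfolding \<tau>_def by (subst card_UN_disjoint) auto
    also have "(\<Union>a. {i\<in>{..<M}. w i = a}) = {..<M}" by auto
    finally have "(\<Sum>a\<in>UNIV. real (\<tau> a)) = real M" by (simp flip: of_nat_sum)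
    with pos[of \<tau>] have "\<delta> * real M ^ m \<le> (\<Sum>t\<in>T. c t * (\<Prod>k<m. real (\<tau> (v t k))))" by simp
    also have "\<dots> = (\<Sum>t\<in>T. c t * real (card (F M \<inter> H w t)))"
      by (simp only: cardFH)
    also have "\<dots> \<le>
        (\<Sum>t\<in>T. c t * real (card (I M \<inter> H w t)) + \<bar>c t\<bar> * real (card (F M - I M)))"
    proof (rule sum_mono)
      fix t
      have "F M \<inter> H w t = (I M \<inter> H w t) \<union> ((F M - I M) \<inter> H w t)" using IF by auto
      then have "card (F M \<inter> H w t) = card (I M \<inter> H w t) + card ((F M - I M) \<inter> H w t)"
        using finF finite_subset[OF IF finF] by (simp add: card_Un_disjoint disjoint_iff)
      moreover have "c t * real (card ((F M - I M) \<inter> H w t)) \<le> \<bar>c t\<bar> * real (card (F M - I M))"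
        using finF by (intro mult_mono) (auto intro!: card_mono)
      ultimately show "c t * real (card (F M \<inter> H w t)) \<le>
          c t * real (card (I M \<inter> H w t)) + \<bar>c t\<bar> * real (card (F M - I M))"
        by (simp add: distrib_left)
    qed
    also have "\<dots> = K w + C * real (card (F M - I M))"
      by (simp add: sum.distrib K_def C_def sum_distrib_right)
    finally show ?thesis using bad by simp
  qed
  define P where "P = (\<Sum>t\<in>T. pconst (c t) * (\<Prod>k<m. y (v t k)))"
  define Y where "Y = (\<Sum>a\<in>UNIV. y a)"
  have ob: "of_bool b = (pconst (of_bool b) :: 'n rpoly)" for b by auto
  have each: "(\<Prod>k<m. y (v t k)) * Y ^ (M - m) =
      (\<Sum>w\<in>W. pconst (of_bool (\<iota> \<in> H w t)) * (\<Prod>i<M. y (w i)))" if "\<iota> \<in> I M" for t \<iota>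
    unfolding Y_def W_def ob[symmetric] H_def mem_Collect_eq
    using that by (intro prod_mult_power_eq_sum_words) (auto simp: I_def F_def)
  have cnt: "real (card (I M \<inter> H w t)) = (\<Sum>\<iota>\<in>I M. of_bool (\<iota> \<in> H w t))" for w t
    using finite_subset[OF IF finF] by (simp add: of_bool_def sum.If_cases Int_def)
  have "pconst (card (I M)) * (P * Y ^ (M - m)) =
      (\<Sum>\<iota>\<in>I M. \<Sum>t\<in>T. pconst (c t) * ((\<Prod>k<m. y (v t k)) * Y ^ (M - m)))"
    by (simp add: P_def sum_distrib_right pconst_def mult.assoc)
  also have "\<dots> = (\<Sum>\<iota>\<in>I M. \<Sum>t\<in>T. \<Sum>w\<in>W. pconst (c t * of_bool (\<iota> \<in> H w t)) * (\<Prod>i<M. y (w i)))"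
    by (intro sum.cong refl) (simp only: each sum_distrib_left pconst_mult mult.assoc)
  also have "\<dots> = (\<Sum>\<iota>\<in>I M. \<Sum>w\<in>W. \<Sum>t\<in>T. pconst (c t * of_bool (\<iota> \<in> H w t)) * (\<Prod>i<M. y (w i)))"
    by (intro sum.cong refl sum.swap)
  also have "\<dots> = (\<Sum>w\<in>W. \<Sum>\<iota>\<in>I M. \<Sum>t\<in>T. pconst (c t * of_bool (\<iota> \<in> H w t)) * (\<Prod>i<M. y (w i)))"
    by (rule sum.swap)
  also have "\<dots> = (\<Sum>w\<in>W. \<Sum>t\<in>T. \<Sum>\<iota>\<in>I M. pconst (c t * of_bool (\<iota> \<in> H w t)) * (\<Prod>i<M. y (w i)))"
    by (intro sum.cong refl sum.swap)
  also have "\<dots> = (\<Sum>w\<in>W. pconst (K w) * (\<Prod>i<M. y (w i)))"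
    by (simp only: K_def cnt pconst_sum sum_distrib_right sum_distrib_left)
  also have "\<dots> \<in> SOS"
    by (intro SOS_sum SOS_mult SOS_prod SOS_pconst K y)
  finally have "pconst (1 / card (I M)) * (pconst (card (I M)) * (P * Y ^ (M - m))) \<in> SOS"
    by (rule SOS_mult[OF SOS_pconst, rotated]) simp
  then have "P * Y ^ (M - m) \<in> SOS"
    using M by (simp add: mult.assoc[symmetric] pconst_mult[symmetric])
  then show ?thesis unfolding P_def Y_def by blast
qed

section \<open>Positive polynomials that are even in every variable\<close>

text \<open>
  The alphabet for Polya's theorem consists of the squares of the variables together with the
  constant 1, which acts as a homogenizing variable; the sum of the letters is $1 + |X|^2$.
\<close>

definition homvar :: "'n option \<Rightarrow> 'n rpoly" where
  "homvar a = (case a of None \<Rightarrow> 1 | Some j \<Rightarrow> pvar j ^ 2)"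

lemma even_monom_eq_prod_homvar:
  fixes \<beta> :: "'n::finite mindex"
  shows "mindex_deg \<beta> \<le> m \<Longrightarrow> \<exists>v. (\<Prod>k<m. homvar (v k)) = monom (\<beta> + \<beta>)"
proof (induction m arbitrary: \<beta>)
  case 0
  then show ?case by (simp add: mindex_deg_eq_0_iff)
next
  case (Suc m)
  show ?case
  proof (cases "\<beta> = 0")
    case True
    then show ?thesis by (intro exI[of _ "\<lambda>_. None"]) (simp add: homvar_def)
  next
    case False
    then obtain j \<beta>' where \<beta>: "\<beta> = \<beta>' + Poly_Mapping.single j 1" by (rule mindex_pop)
    then obtain v where v: "(\<Prod>k<m. homvar (v k)) = monom (\<beta>' + \<beta>')"
      using Suc.IH[of \<beta>'] Suc.prems by (auto simp: mindex_deg_add)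
    have "(\<Prod>k<Suc m. homvar ((v(m := Some j)) k)) = (\<Prod>k<m. homvar (v k)) * pvar j ^ 2"
      by (simp add: homvar_def)
    also have "\<dots> = monom (\<beta> + \<beta>)"
      by (simp add: v \<beta> monom_add pvar_def power2_eq_square mult_ac)
    finally show ?thesis by blast
  qed
qed

lemma usq_eq_sum_homvar: "usq = (\<Sum>a\<in>UNIV. homvar a)"
  by (simp add: usq_def UNIV_option_conv homvar_def sum.reindex)

text \<open>
  With the parity as a parameter, the rule for products covers the squares of even parts and of odd
  parts at once.
\<close>

definition parity_in :: "'n \<Rightarrow> bool \<Rightarrow> 'n rpoly \<Rightarrow> bool" where
  "parity_in j b p \<longleftrightarrow> (\<forall>\<alpha>\<in>Poly_Mapping.keys p. even (Poly_Mapping.lookup \<alpha> j) = b)"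

text \<open>
  An even polynomial is a polynomial in the squares $X_j^2$, so homogenizing with the letter \<open>None\<close>
  turns it into a form $q$ of degree $m$ in the letters.  A point $\tau$ of the nonnegative orthant
  with $\tau_0 > 0$ comes from the real point with coordinates $\sqrt{\tau_j / \tau_0}$, so the assumed
  lower bound becomes $q(\tau) \ge \epsilon (\sum_a \tau_a)^m$; this extends to $\tau_0 = 0$ by continuity.
  Polya's theorem applies, and the letters are squares.
\<close>

lemma positive_even_times_usq_power_SOS:
  fixes p :: "'n::finite rpoly"
  assumes deg: "deg_le p (2 * m)" and ev: "\<And>j. parity_in j True p"
    and "\<epsilon> > 0" and pos: "\<And>x. peval p x \<ge> \<epsilon> * peval usq x ^ m"
  shows "\<exists>N. p * usq ^ N \<in> SOS"
proof -
  define T where "T = Poly_Mapping.keys p"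
  define c where "c = Poly_Mapping.lookup p"
  have "\<exists>v. (\<Prod>k<m. homvar (v k)) = monom \<alpha>" if "\<alpha> \<in> T" for \<alpha>
  proof -
    define \<beta> where "\<beta> = Poly_Mapping.map (\<lambda>n. n div 2) \<alpha>"
    have "\<alpha> = \<beta> + \<beta>"
    proof (rule poly_mapping_eqI)
      fix j
      have "even (Poly_Mapping.lookup \<alpha> j)" using ev that by (simp add: parity_in_def T_def)
      then show "Poly_Mapping.lookup \<alpha> j = Poly_Mapping.lookup (\<beta> + \<beta>) j"
        by (auto simp: \<beta>_def lookup_add map.rep_eq when_def)
    qed
    then show ?thesis
      using even_monom_eq_prod_homvar[of \<beta> m] deg that by (auto simp: deg_le_def T_def mindex_deg_add)
  qed
  then obtain v where v: "\<And>\<alpha>. \<alpha> \<in> T \<Longrightarrow> (\<Prod>k<m. homvar (v \<alpha> k)) = monom \<alpha>" by metis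
  have p: "p = (\<Sum>\<alpha>\<in>T. pconst (c \<alpha>) * (\<Prod>k<m. homvar (v \<alpha> k)))"
    using rpoly_monom_expansion[of p] by (simp add: v T_def c_def)
  define q where "q \<tau> = (\<Sum>\<alpha>\<in>T. c \<alpha> * (\<Prod>k<m. \<tau> (v \<alpha> k)))" for \<tau> :: "'n option \<Rightarrow> real"
  have pos1: "q \<tau> \<ge> \<epsilon> * (\<Sum>a\<in>UNIV. \<tau> a) ^ m" if \<tau>: "\<And>a. \<tau> a \<ge> 0" "\<tau> None > 0" for \<tau>
  proof -
    define x :: "real ^ 'n" where "x = (\<chi> j. sqrt (\<tau> (Some j) / \<tau> None))"
    have val: "peval (homvar a) x = \<tau> a / \<tau> None" for a
      using \<tau> by (cases a) (auto simp: homvar_def x_def)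
    have "\<epsilon> * ((\<Sum>a\<in>UNIV. \<tau> a) / \<tau> None) ^ m \<le> peval p x"
      using pos[of x] by (simp add: usq_eq_sum_homvar val sum_divide_distrib)
    also have "peval p x = q \<tau> / \<tau> None ^ m"
      by (subst p) (simp add: val q_def sum_divide_distrib prod_dividef)
    finally show ?thesis using \<tau> by (simp add: field_simps)
  qed
  have pos2: "q \<tau> \<ge> \<epsilon> * (\<Sum>a\<in>UNIV. \<tau> a) ^ m" if \<tau>: "\<And>a. \<tau> a \<ge> 0" for \<tau>
  proof -
    define \<rho> where "\<rho> s a = \<tau> a + s * of_bool (a = None)" for s a
    have "((\<lambda>s. q (\<rho> s) - \<epsilon> * (\<Sum>a\<in>UNIV. \<rho> s a) ^ m) \<longlongrightarrow>
        q (\<rho> 0) - \<epsilon> * (\<Sum>a\<in>UNIV. \<rho> 0 a) ^ m) (at_right 0)"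
      unfolding q_def \<rho>_def by (intro tendsto_intros)
    moreover have "eventually (\<lambda>s. 0 \<le> q (\<rho> s) - \<epsilon> * (\<Sum>a\<in>UNIV. \<rho> s a) ^ m) (at_right 0)"
      using eventually_at_right_less
    proof eventually_elim
      case (elim s)
      then show ?case using pos1[of "\<rho> s"] \<tau> by (auto simp: \<rho>_def add_nonneg_pos)
    qed
    ultimately have "0 \<le> q (\<rho> 0) - \<epsilon> * (\<Sum>a\<in>UNIV. \<rho> 0 a) ^ m"
      by (rule tendsto_lowerbound) simp
    moreover have "\<rho> 0 = \<tau>" by (simp add: \<rho>_def fun_eq_iff)
    ultimately show ?thesis by simp
  qed
  have "\<exists>N. (\<Sum>\<alpha>\<in>T. pconst (c \<alpha>) * (\<Prod>k<m. homvar (v \<alpha> k))) * (\<Sum>a\<in>UNIV. homvar a) ^ N \<in> SOS"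
  proof (rule polya_sampling)
    show "homvar a \<in> SOS" for a :: "'n option" by (cases a) (auto simp: homvar_def)
    show "finite T" by (simp add: T_def)
    show "\<epsilon> > 0" by fact
    show "\<epsilon> * (\<Sum>a\<in>UNIV. real (\<tau> a)) ^ m \<le> (\<Sum>t\<in>T. c t * (\<Prod>k<m. real (\<tau> (v t k))))" for \<tau>
      using pos2[of "\<lambda>a. real (\<tau> a)"] by (simp add: q_def)
  qed
  then show ?thesis unfolding p[symmetric] usq_eq_sum_homvar .
qed

section \<open>Splitting a polynomial by parity\<close>

definition restrict_terms :: "('n mindex \<Rightarrow> bool) \<Rightarrow> 'n rpoly \<Rightarrow> 'n rpoly" where
  "restrict_terms Q p =
     (\<Sum>\<alpha> | \<alpha> \<in> Poly_Mapping.keys p \<and> Q \<alpha>. Poly_Mapping.single \<alpha> (Poly_Mapping.lookup p \<alpha>))"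

lemma lookup_restrict_terms:
  "Poly_Mapping.lookup (restrict_terms Q p) \<alpha> = (if Q \<alpha> then Poly_Mapping.lookup p \<alpha> else 0)"
proof -
  have "finite {\<alpha>. \<alpha> \<in> Poly_Mapping.keys p \<and> Q \<alpha>}" by simp
  then show ?thesis
    by (auto simp: restrict_terms_def lookup_sum lookup_single when_def in_keys_iff sum.delta)
qed

lemma keys_restrict_terms: "Poly_Mapping.keys (restrict_terms Q p) = {\<alpha>\<in>Poly_Mapping.keys p. Q \<alpha>}"
  by (auto simp: in_keys_iff lookup_restrict_terms split: if_splits)

lemma restrict_terms_add_complement: "restrict_terms Q p + restrict_terms (\<lambda>\<alpha>. \<not> Q \<alpha>) p = p"
  by (rule poly_mapping_eqI) (simp add: lookup_add lookup_restrict_terms)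

lemma deg_le_restrict_terms: "deg_le p d \<Longrightarrow> deg_le (restrict_terms Q p) d"
  by (auto simp: deg_le_def keys_restrict_terms)

lemma parity_in_add: "parity_in j b p \<Longrightarrow> parity_in j b q \<Longrightarrow> parity_in j b (p + q)"
  unfolding parity_in_def using keys_add[of p q] by blast

lemma parity_in_uminus: "parity_in j b p \<Longrightarrow> parity_in j b (- p)"
  by (simp add: parity_in_def keys_def)

lemma parity_in_diff: "parity_in j b p \<Longrightarrow> parity_in j b q \<Longrightarrow> parity_in j b (p - q)"
  using parity_in_add[of j b p "- q"] parity_in_uminus[of j b q] by simp

lemma parity_in_mult:
  assumes "parity_in j b p" "parity_in j c q"
  shows "parity_in j (b = c) (p * q)"
proof -
  have "even (Poly_Mapping.lookup (\<alpha> + \<beta>) j) = (b = c)"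
    if "\<alpha> \<in> Poly_Mapping.keys p" "\<beta> \<in> Poly_Mapping.keys q" for \<alpha> \<beta>
    using that assms by (auto simp: parity_in_def lookup_add)
  then show ?thesis unfolding parity_in_def using keys_mult[of p q] by blast
qed

lemma parity_in_square: "parity_in j b p \<Longrightarrow> parity_in j True (p ^ 2)"
  using parity_in_mult[of j b p b p] by (simp add: power2_eq_square)

lemma parity_in_pconst: "parity_in j True (pconst c)"
  by (simp add: parity_in_def pconst_def)

lemma parity_in_power: "parity_in j True p \<Longrightarrow> parity_in j True (p ^ k)"
  using parity_in_pconst[of j 1] parity_in_mult[of j True p True]
  by (induction k) auto

lemma parity_in_sum: "(\<And>i. i \<in> I \<Longrightarrow> parity_in j b (p i)) \<Longrightarrow> parity_in j b (\<Sum>i\<in>I. p i)"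
  by (induction I rule: infinite_finite_induct) (auto intro: parity_in_add simp: parity_in_def[of _ _ 0])

lemma parity_in_usq: "parity_in j True usq"
proof -
  have "parity_in j (i \<noteq> j) (pvar i)" for i
    by (auto simp: parity_in_def pvar_def lookup_single when_def)
  from parity_in_square[OF this] show ?thesis
    unfolding usq_def using parity_in_pconst[of j 1]
    by (intro parity_in_add parity_in_sum) auto
qed

definition reflect :: "'n \<Rightarrow> real ^ 'n \<Rightarrow> real ^ 'n::finite" where
  "reflect j x = (\<chi> i. if i = j then - (x $ i) else x $ i)"

lemma monom_val_reflect: "monom_val \<alpha> (reflect j x) = (- 1) ^ Poly_Mapping.lookup \<alpha> j * monom_val \<alpha> x"
proof -
  have "monom_val \<alpha> (reflect j x) = (\<Prod>i\<in>UNIV. (if i = j then (- 1) ^ Poly_Mapping.lookup \<alpha> j else 1) *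
      (x $ i) ^ Poly_Mapping.lookup \<alpha> i)"
    unfolding monom_val_def by (intro prod.cong) (auto simp: reflect_def power_minus[of "x $ j"])
  then show ?thesis by (simp add: prod.distrib monom_val_def)
qed

lemma peval_reflect:
  assumes "parity_in j b p"
  shows "peval p (reflect j x) = (if b then 1 else - 1) * peval p x"
proof -
  have "peval p (reflect j x) =
      (\<Sum>\<alpha>\<in>Poly_Mapping.keys p. (if b then 1 else - 1) * (Poly_Mapping.lookup p \<alpha> * monom_val \<alpha> x))"
    unfolding peval_superset[OF finite_keys order_refl]
    by (intro sum.cong) (use assms in \<open>auto simp: parity_in_def monom_val_reflect\<close>)
  then show ?thesis
    by (simp add: sum_distrib_left peval_superset[OF finite_keys order_refl])
qed

section \<open>Sum-of-squares multipliers of positive polynomials\<close>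

text \<open>
  A sum of squares lying uniformly inside the cone.  Being preserved by products, this strengthening
  can be carried through the induction below, and it is what leaves room to absorb terms of lower
  degree at the end.
\<close>

definition strongly_SOS :: "nat \<Rightarrow> 'n::finite rpoly \<Rightarrow> bool" where
  "strongly_SOS k s \<longleftrightarrow> (\<exists>\<delta>>0. pconst \<delta> * usq ^ k \<preceq> s)"

lemma strongly_SOS_imp_SOS: "strongly_SOS k s \<Longrightarrow> s \<in> SOS"
proof -
  assume "strongly_SOS k s"
  then obtain \<delta> where \<delta>: "\<delta> > 0" "pconst \<delta> * usq ^ k \<preceq> s" by (auto simp: strongly_SOS_def)
  have "0 \<preceq> pconst \<delta> * usq ^ k"
    using \<delta> unfolding SOS_iff_sos_le[symmetric] by (intro pconst_mult_SOS usq_SOS) auto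
  then show ?thesis using \<delta> sos_le_trans SOS_iff_sos_le by blast
qed

lemma strongly_SOS_mult:
  assumes "strongly_SOS k s" "strongly_SOS l t"
  shows "strongly_SOS (k + l) (s * t)"
proof -
  obtain \<delta> where \<delta>: "\<delta> > 0" "pconst \<delta> * usq ^ k \<preceq> s" using assms by (auto simp: strongly_SOS_def)
  obtain \<epsilon> where \<epsilon>: "\<epsilon> > 0" "pconst \<epsilon> * usq ^ l \<preceq> t" using assms by (auto simp: strongly_SOS_def)
  have "(pconst \<delta> * usq ^ k) * (pconst \<epsilon> * usq ^ l) \<preceq> s * t"
    using \<delta> \<epsilon> by (intro sos_le_mult) (simp_all flip: SOS_iff_sos_le add: pconst_mult_SOS)
  also have "(pconst \<delta> * usq ^ k) * (pconst \<epsilon> * usq ^ l) = pconst (\<delta> * \<epsilon>) * usq ^ (k + l)"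
    by (simp add: pconst_mult power_add mult_ac)
  finally show ?thesis using \<delta> \<epsilon> unfolding strongly_SOS_def by (intro exI[of _ "\<delta> * \<epsilon>"]) auto
qed

lemma strongly_SOS_add_SOS: "strongly_SOS k s \<Longrightarrow> t \<in> SOS \<Longrightarrow> strongly_SOS k (t + s)"
  unfolding strongly_SOS_def sos_le_def using SOS_add[of t] by (metis add_diff_eq)

lemma strongly_SOS_usq: "c > 0 \<Longrightarrow> strongly_SOS k (pconst c * usq ^ k)"
  unfolding strongly_SOS_def by (intro exI[of _ c]) simp

text \<open>
  Habicht's argument, by induction on the variables in which $p$ is not even.  Let $p = A + B$ with $A$
  even and $B$ odd in $X_j$.  Then $2 A p = p^2 + (A^2 - B^2)$, and both $A$ and $A^2 - B^2$ are even in
  $X_j$.  Both inherit the lower bound: if $x'$ is $x$ with the sign of its $j$-th coordinate changed, then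
  $A(x) = (p(x) + p(x')) / 2$ and $(A^2 - B^2)(x) = p(x) p(x')$.  If $s_1$ and $s_2$ are multipliers for $A$ and
  $A^2 - B^2$, then $2 (s_1 A) s_2$ is one for $p$.
\<close>

lemma positive_has_SOS_multiplier:
  fixes p :: "'n::finite rpoly"
  assumes "finite S" "deg_le p (2 * m)" "\<epsilon> > 0" "\<And>x. peval p x \<ge> \<epsilon> * peval usq x ^ m"
    and "\<And>j. j \<notin> S \<Longrightarrow> parity_in j True p"
  shows "\<exists>\<sigma> k. deg_le \<sigma> (2 * k) \<and> strongly_SOS k \<sigma> \<and> strongly_SOS (k + m) (\<sigma> * p)"
  using assms
proof (induction S arbitrary: p m \<epsilon> rule: finite_induct)
  case empty
  \<comment> \<open>Half of the lower bound is set aside to make the product strongly a sum of squares.\<close>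
  define p' where "p' = p - pconst (\<epsilon> / 2) * usq ^ m"
  have "\<exists>N. p' * usq ^ N \<in> SOS"
  proof (rule positive_even_times_usq_power_SOS)
    show "deg_le p' (2 * m)"
      using empty.prems(1) deg_le_mult[OF deg_le_pconst[of "\<epsilon> / 2" 0] deg_le_usq_power[of m]]
      by (auto simp: p'_def intro: deg_le_diff)
    show "parity_in j True p'" for j
      using empty.prems(4)[of j]
        parity_in_mult[OF parity_in_pconst[of j "\<epsilon> / 2"] parity_in_power[OF parity_in_usq[of j], of m]]
      by (auto simp: p'_def intro: parity_in_diff)
    show "\<epsilon> / 2 > 0" using empty.prems by simp
    show "\<epsilon> / 2 * peval usq x ^ m \<le> peval p' x" for x
      using empty.prems(3)[of x] by (simp add: p'_def)
  qed
  then obtain N where N: "p' * usq ^ N \<in> SOS" by blast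
  have "usq ^ N * p = p' * usq ^ N + pconst (\<epsilon> / 2) * usq ^ (N + m)"
    by (simp add: p'_def algebra_simps power_add)
  then have "strongly_SOS (N + m) (usq ^ N * p)"
    using strongly_SOS_add_SOS[OF strongly_SOS_usq N] empty.prems(2) by simp
  moreover have "strongly_SOS N (usq ^ N :: 'n rpoly)" using strongly_SOS_usq[of 1 N] by simp
  ultimately show ?case using deg_le_usq_power by blast
next
  case (insert j S)
  define A where "A = restrict_terms (\<lambda>\<alpha>. even (Poly_Mapping.lookup \<alpha> j)) p"
  define B where "B = restrict_terms (\<lambda>\<alpha>. odd (Poly_Mapping.lookup \<alpha> j)) p"
  define Q where "Q = A ^ 2 - B ^ 2"
  have p: "p = A + B" unfolding A_def B_def by (rule restrict_terms_add_complement[symmetric])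
  have par: "parity_in j True A" "parity_in j False B"
    by (auto simp: A_def B_def parity_in_def keys_restrict_terms)
  have par': "parity_in i True A" "parity_in i True B" if "i \<notin> insert j S" for i
    using insert.prems(4)[OF that] by (auto simp: A_def B_def parity_in_def keys_restrict_terms)
  have deg: "deg_le A (2 * m)" "deg_le B (2 * m)"
    using insert.prems(1) by (auto simp: A_def B_def intro: deg_le_restrict_terms)
  have posr: "\<epsilon> * peval usq x ^ m \<le> peval A x - peval B x" for x
    using insert.prems(3)[of "reflect j x"] peval_reflect[OF par(1)] peval_reflect[OF par(2)]
      peval_reflect[OF parity_in_usq[of j]]
    by (simp add: p)
  have pos: "\<epsilon> * peval usq x ^ m \<le> peval A x + peval B x" for x
    using insert.prems(3)[of x] by (simp add: p)
  have "\<exists>\<sigma> k. deg_le \<sigma> (2 * k) \<and> strongly_SOS k \<sigma> \<and> strongly_SOS (k + m) (\<sigma> * A)"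
  proof (rule insert.IH)
    show "\<epsilon> * peval usq x ^ m \<le> peval A x" for x using pos[of x] posr[of x] by simp
    show "parity_in i True A" if "i \<notin> S" for i using that par par' by (cases "i = j") auto
  qed (use insert.prems deg in auto)
  then obtain s1 k1 where s1: "deg_le s1 (2 * k1)" "strongly_SOS k1 s1" "strongly_SOS (k1 + m) (s1 * A)"
    by blast
  have "\<exists>\<sigma> k. deg_le \<sigma> (2 * k) \<and> strongly_SOS k \<sigma> \<and> strongly_SOS (k + 2 * m) (\<sigma> * Q)"
  proof (rule insert.IH)
    show "deg_le Q (2 * (2 * m))"
      using deg_le_power[OF deg(1), of 2] deg_le_power[OF deg(2), of 2]
      unfolding Q_def by (intro deg_le_diff)
    show "\<epsilon> ^ 2 > 0" using insert.prems by simp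
    show "\<epsilon> ^ 2 * peval usq x ^ (2 * m) \<le> peval Q x" for x
    proof -
      have "0 \<le> \<epsilon> * peval usq x ^ m" using insert.prems by (simp add: peval_usq)
      then have "(\<epsilon> * peval usq x ^ m) * (\<epsilon> * peval usq x ^ m) \<le>
          (peval A x + peval B x) * (peval A x - peval B x)"
        using pos[of x] posr[of x] by (intro mult_mono) auto
      then show ?thesis
        by (simp add: Q_def power2_eq_square algebra_simps power_mult power_mult_distrib)
    qed
    show "parity_in i True Q" if "i \<notin> S" for i
      using that par par' unfolding Q_def
      by (cases "i = j") (auto intro!: parity_in_diff intro: parity_in_square)
  qed
  then obtain s2 k2 where s2: "deg_le s2 (2 * k2)" "strongly_SOS k2 s2" "strongly_SOS (k2 + 2 * m) (s2 * Q)"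
    by blast
  define \<sigma> where "\<sigma> = pconst 2 * (s1 * A * s2)"
  have two: "strongly_SOS 0 (pconst 2 :: 'n rpoly)" using strongly_SOS_usq[of 2 0] by simp
  have "deg_le \<sigma> (0 + ((2 * k1 + 2 * m) + 2 * k2))"
    unfolding \<sigma>_def by (intro deg_le_mult deg s1 s2 deg_le_pconst)
  then have "deg_le \<sigma> (2 * (k1 + m + k2))" by (simp add: algebra_simps)
  moreover have "strongly_SOS (k1 + m + k2) \<sigma>"
    using strongly_SOS_mult[OF two strongly_SOS_mult[OF s1(3) s2(2)]] by (simp add: \<sigma>_def)
  moreover have "strongly_SOS (k1 + m + k2 + m) (\<sigma> * p)"
  proof -
    have "\<sigma> * p = (s1 * s2) * p ^ 2 + s1 * (s2 * Q)"
      unfolding \<sigma>_def Q_def p pconst_2 by (simp add: algebra_simps power2_eq_square)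
    moreover have "(s1 * s2) * p ^ 2 \<in> SOS"
      by (intro SOS_mult SOS_power2 strongly_SOS_imp_SOS[OF s1(2)] strongly_SOS_imp_SOS[OF s2(2)])
    moreover have "strongly_SOS (k1 + (k2 + 2 * m)) (s1 * (s2 * Q))"
      by (intro strongly_SOS_mult s1 s2)
    moreover have "k1 + m + k2 + m = k1 + (k2 + 2 * m)" by simp
    ultimately show ?thesis by (simp only: strongly_SOS_add_SOS)
  qed
  ultimately show ?case by blast
qed

section \<open>Coercivity from a positive definite leading form\<close>

lemma continuous_on_peval: "continuous_on S (peval p)"
  unfolding peval_def by (intro continuous_intros)

lemma monom_val_scaleR: "monom_val \<alpha> (r *\<^sub>R x) = r ^ mindex_deg \<alpha> * monom_val \<alpha> x"
  by (simp add: monom_val_def mindex_deg_def power_mult_distrib prod.distrib power_sum)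

lemma abs_monom_val_le: "\<bar>monom_val \<alpha> x\<bar> \<le> norm x ^ mindex_deg \<alpha>"
proof -
  have "\<bar>monom_val \<alpha> x\<bar> = (\<Prod>j\<in>UNIV. \<bar>x $ j\<bar> ^ Poly_Mapping.lookup \<alpha> j)"
    by (simp add: monom_val_def abs_prod power_abs)
  also have "\<dots> \<le> (\<Prod>j\<in>UNIV. norm x ^ Poly_Mapping.lookup \<alpha> j)"
    by (intro prod_mono conjI power_mono component_le_norm_cart) auto
  finally show ?thesis by (simp add: mindex_deg_def power_sum)
qed

lemma abs_peval_le:
  assumes "deg_le p d" "norm x \<ge> 1"
  shows "\<bar>peval p x\<bar> \<le> (\<Sum>\<alpha>\<in>Poly_Mapping.keys p. \<bar>Poly_Mapping.lookup p \<alpha>\<bar>) * norm x ^ d"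
proof -
  have "\<bar>peval p x\<bar> \<le> (\<Sum>\<alpha>\<in>Poly_Mapping.keys p. \<bar>Poly_Mapping.lookup p \<alpha> * monom_val \<alpha> x\<bar>)"
    unfolding peval_superset[OF finite_keys order_refl] by (rule sum_abs)
  also have "\<dots> \<le> (\<Sum>\<alpha>\<in>Poly_Mapping.keys p. \<bar>Poly_Mapping.lookup p \<alpha>\<bar> * norm x ^ d)"
  proof (rule sum_mono)
    fix \<alpha> assume "\<alpha> \<in> Poly_Mapping.keys p"
    then have "norm x ^ mindex_deg \<alpha> \<le> norm x ^ d"
      using assms by (intro power_increasing) (auto simp: deg_le_def)
    then show "\<bar>Poly_Mapping.lookup p \<alpha> * monom_val \<alpha> x\<bar> \<le> \<bar>Poly_Mapping.lookup p \<alpha>\<bar> * norm x ^ d"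
      using abs_monom_val_le[of \<alpha> x] by (simp add: abs_mult mult_left_mono)
  qed
  finally show ?thesis by (simp add: sum_distrib_right)
qed

lemma peval_homogeneous:
  assumes "\<And>\<alpha>. \<alpha> \<in> Poly_Mapping.keys p \<Longrightarrow> mindex_deg \<alpha> = d"
  shows "peval p (r *\<^sub>R x) = r ^ d * peval p x"
  unfolding peval_superset[OF finite_keys order_refl]
  by (simp add: sum_distrib_left monom_val_scaleR assms mult_ac)

text \<open>
  The minimum over the unit sphere is positive, and homogeneity spreads the bound to all of
  $\mathbb{R}^n$.  Parity of the degree comes from comparing the values at $x$ and $-x$.
\<close>

lemma pd_homogeneous_bounds:
  fixes p :: "'n::finite rpoly"
  assumes hom: "\<And>\<alpha>. \<alpha> \<in> Poly_Mapping.keys p \<Longrightarrow> mindex_deg \<alpha> = d" and pd: "positive_definite p"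
  shows "even d" and "\<exists>c>0. \<forall>x. peval p x \<ge> c * norm x ^ d"
proof -
  have "sphere (0 :: real ^ 'n) 1 \<noteq> {}" by simp
  then obtain x0 where x0: "x0 \<in> sphere 0 1" "\<And>x. x \<in> sphere 0 1 \<Longrightarrow> peval p x0 \<le> peval p x"
    using continuous_attains_inf[OF compact_sphere _ continuous_on_peval[of _ p]] by blast
  have "x0 \<noteq> 0" using x0 by auto
  then have c: "peval p x0 > 0" "peval p (- x0) > 0" using pd by (simp_all add: positive_definite_def)
  show "even d"
    using c peval_homogeneous[OF hom, where r = "- 1" and x = x0] by (cases "even d") auto
  have "peval p x \<ge> peval p x0 * norm x ^ d" for x
  proof (cases "x = 0")
    case True
    then show ?thesis
      using peval_homogeneous[OF hom, where r = 0 and x = x0] by (cases "d = 0") auto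
  next
    case False
    then have "peval p x = norm x ^ d * peval p (x /\<^sub>R norm x)"
      using peval_homogeneous[OF hom, where r = "norm x" and x = "x /\<^sub>R norm x"] by simp
    moreover have "peval p x0 \<le> peval p (x /\<^sub>R norm x)" using False by (intro x0) simp
    ultimately show ?thesis by (metis mult.commute mult_right_mono norm_ge_zero zero_le_power)
  qed
  then show "\<exists>c>0. \<forall>x. peval p x \<ge> c * norm x ^ d" using c by blast
qed

text \<open>
  A positive definite leading form forces the polynomial to be nonzero, so that its degree is a natural
  number.
\<close>

lemma leading_form_cases:
  fixes f :: "'n::finite rpoly"
  assumes pd: "positive_definite (leading_form f)"
  obtains d where "deg_le f d" "\<And>\<alpha>. \<alpha> \<in> Poly_Mapping.keys (leading_form f) \<Longrightarrow> mindex_deg \<alpha> = d"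
    "deg_le (f - leading_form f) (d - 1)"
proof -
  have lf: "leading_form f = restrict_terms (\<lambda>\<alpha>. ereal (real (mindex_deg \<alpha>)) = pdeg f) f"
    by (simp add: leading_form_def hom_component_def restrict_terms_def)
  have "f \<noteq> 0"
  proof
    assume "f = 0"
    then have "leading_form f = 0" unfolding lf by (simp add: restrict_terms_def)
    then show False using pd by (auto simp: positive_definite_def dest!: spec[of _ "axis undefined 1"])
  qed
  define D where "D = mindex_deg ` Poly_Mapping.keys f"
  have D: "finite D" "D \<noteq> {}" using \<open>f \<noteq> 0\<close> by (auto simp: D_def)
  define d where "d = Max D"
  have d: "deg_le f d" using D by (auto simp: d_def deg_le_def D_def)
  have "d \<in> D" using D by (simp add: d_def)
  then obtain \<alpha> where "\<alpha> \<in> Poly_Mapping.keys f" "mindex_deg \<alpha> = d" by (auto simp: D_def)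
  then have "ereal (real d) \<le> pdeg f" unfolding pdeg_def by (auto intro: SUP_upper2)
  then have pdeg: "pdeg f = ereal (real d)" using d pdeg_le_iff by (metis antisym)
  have lf': "leading_form f = restrict_terms (\<lambda>\<alpha>. mindex_deg \<alpha> = d) f"
    by (simp add: lf pdeg)
  then have low: "f - leading_form f = restrict_terms (\<lambda>\<alpha>. mindex_deg \<alpha> \<noteq> d) f"
    using restrict_terms_add_complement[of "\<lambda>\<alpha>. mindex_deg \<alpha> = d" f] by (simp add: diff_eq_eq add.commute)
  show thesis
  proof (rule that[OF d])
    show "mindex_deg \<alpha> = d" if "\<alpha> \<in> Poly_Mapping.keys (leading_form f)" for \<alpha>
      using that by (simp add: lf' keys_restrict_terms)
    show "deg_le (f - leading_form f) (d - 1)"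
      using d unfolding low deg_le_def by (force simp: keys_restrict_terms)
  qed
qed

text \<open>
  Outside a ball the leading form outweighs the remaining terms; inside it the constant $C$ helps.
\<close>

lemma pd_leading_form_coercive:
  fixes f :: "'n::finite rpoly"
  assumes pd: "positive_definite (leading_form f)"
  obtains m C \<epsilon> where "deg_le f (2 * m)" "\<epsilon> > 0" "\<And>x. peval f x + C \<ge> \<epsilon> * peval usq x ^ m"
proof -
  obtain d where d: "deg_le f d" "\<And>\<alpha>. \<alpha> \<in> Poly_Mapping.keys (leading_form f) \<Longrightarrow> mindex_deg \<alpha> = d"
    "deg_le (f - leading_form f) (d - 1)"
    using leading_form_cases[OF pd] by blast
  obtain m where m: "d = 2 * m" using pd_homogeneous_bounds(1)[OF d(2) pd] by blast
  obtain c where c: "c > 0" "\<And>x. peval (leading_form f) x \<ge> c * norm x ^ d"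
    using pd_homogeneous_bounds(2)[OF d(2) pd] by blast
  define r where "r = f - leading_form f"
  define K where "K = (\<Sum>\<alpha>\<in>Poly_Mapping.keys r. \<bar>Poly_Mapping.lookup r \<alpha>\<bar>)"
  define R where "R = max 1 (2 * K / c)"
  define \<epsilon> where "\<epsilon> = c / 2 / 2 ^ m"
  have \<epsilon>: "\<epsilon> > 0" using c by (simp add: \<epsilon>_def)
  have far: "\<epsilon> * peval usq x ^ m \<le> peval f x" if x: "norm x \<ge> R" and "m > 0" for x
  proof -
    have x1: "norm x \<ge> 1" and xK: "K \<le> c / 2 * norm x"
      using x c by (auto simp: R_def field_simps)
    have "peval usq x \<le> 2 * (norm x)\<^sup>2" using x1 by (simp add: peval_usq)
    then have "peval usq x ^ m \<le> (2 * (norm x)\<^sup>2) ^ m" by (intro power_mono) (simp_all add: peval_usq)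
    then have "\<epsilon> * peval usq x ^ m \<le> \<epsilon> * (2 * (norm x)\<^sup>2) ^ m"
      using \<epsilon> by (intro mult_left_mono) auto
    also have "\<dots> = c / 2 * norm x ^ d" by (simp add: \<epsilon>_def m power_mult_distrib power_mult)
    also have "\<dots> = c * norm x ^ d - c / 2 * norm x * norm x ^ (d - 1)"
      using \<open>m > 0\<close> m by (simp add: power_eq_if)
    also have "\<dots> \<le> c * norm x ^ d - K * norm x ^ (d - 1)"
      using xK by (intro diff_left_mono mult_right_mono) auto
    also have "\<dots> \<le> peval (leading_form f) x + peval r x"
      using c(2)[of x] abs_peval_le[OF d(3) x1] by (simp add: K_def r_def)
    also have "\<dots> = peval f x" by (simp add: r_def)
    finally show ?thesis .
  qed
  have "cball (0 :: real ^ 'n) R \<noteq> {}" by (auto simp: R_def)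
  then obtain x0 where x0: "\<And>x. x \<in> cball 0 R \<Longrightarrow>
      peval (f - pconst \<epsilon> * usq ^ m) x0 \<le> peval (f - pconst \<epsilon> * usq ^ m) x"
    using continuous_attains_inf[OF compact_cball _ continuous_on_peval[of _ "f - pconst \<epsilon> * usq ^ m"]]
    by blast
  define C where "C = \<bar>peval (f - pconst \<epsilon> * usq ^ m) x0\<bar>"
  show thesis
  proof (cases "m = 0")
    case True
    then have "\<And>\<alpha>. \<alpha> \<in> Poly_Mapping.keys f \<Longrightarrow> \<alpha> = 0"
      using d(1) by (auto simp: deg_le_def m mindex_deg_eq_0_iff)
    then have "peval f x = Poly_Mapping.lookup f 0" for x
      by (subst peval_superset[of "{0}"]) auto
    then have "peval f x + (1 - Poly_Mapping.lookup f 0) \<ge> 1 * peval usq x ^ m" for x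
      using True by simp
    then show thesis using that[of m 1 "1 - Poly_Mapping.lookup f 0"] d m by simp
  next
    case False
    have "\<epsilon> * peval usq x ^ m \<le> peval f x + C" for x
    proof (cases "norm x \<ge> R")
      case True
      have "C \<ge> 0" by (simp add: C_def)
      then show ?thesis using far[OF True] False by simp
    next
      case False
      then have "x \<in> cball 0 R" by simp
      from x0[OF this] show ?thesis by (simp add: C_def)
    qed
    then show thesis using that[of m \<epsilon> C] \<epsilon> d m by simp
  qed
qed

section \<open>Feasibility of (SLS) with a constant underestimator\<close>

text \<open>
  Let $p = f + C$ be bounded below by a multiple of $u^m$, and let $\rho$ be a multiplier for $p$ scaled so
  that $\sigma = \rho - 1$ is a sum of squares.  Then
  $f - b - \sigma (z - f) = \rho p - \rho (C + z) + z - b$.  Since $\rho p$ dominates a multiple of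
  $u^{k+m}$ while $\rho (C + z)$ has degree at most $2 k$, a sufficiently small $b$ makes this a sum of
  squares, provided $m > 0$; a constant $f$ is its own certificate.
\<close>

lemma bounded_below_certificate:
  fixes f :: "'n::finite rpoly"
  assumes pd: "positive_definite (leading_form f)"
  shows "\<exists>b. \<exists>\<sigma>\<in>SOS. f - pconst b - \<sigma> * (pconst z - f) \<in> SOS"
proof -
  obtain m C \<epsilon> where m: "deg_le f (2 * m)" "\<epsilon> > 0" "\<And>x. peval f x + C \<ge> \<epsilon> * peval usq x ^ m"
    using pd_leading_form_coercive[OF pd] by blast
  show ?thesis
  proof (cases m)
    case 0
    then have "\<forall>\<alpha>\<in>Poly_Mapping.keys f. \<alpha> = 0"
      using m(1) by (auto simp: deg_le_def mindex_deg_eq_0_iff)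
    then have "f = pconst (Poly_Mapping.lookup f 0)"
      by (intro poly_mapping_eqI) (auto simp: pconst_def lookup_single when_def in_keys_iff)
    then have "f - pconst (Poly_Mapping.lookup f 0) - 0 * (pconst z - f) \<in> SOS" by simp
    then show ?thesis using SOS_zero by (intro exI bexI)
  next
    case (Suc m')
    define p where "p = f + pconst C"
    have "\<exists>\<sigma> k. deg_le \<sigma> (2 * k) \<and> strongly_SOS k \<sigma> \<and> strongly_SOS (k + m) (\<sigma> * p)"
    proof (rule positive_has_SOS_multiplier[of UNIV])
      show "deg_le p (2 * m)" unfolding p_def by (intro deg_le_add m deg_le_pconst)
      show "\<epsilon> * peval usq x ^ m \<le> peval p x" for x using m by (simp add: p_def)
    qed (use m in auto)
    then obtain \<tau> k \<delta> \<delta>' where \<tau>: "deg_le \<tau> (2 * k)" and \<delta>: "\<delta> > 0" "pconst \<delta> * usq ^ k \<preceq> \<tau>"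
      and \<delta>': "\<delta>' > 0" "pconst \<delta>' * usq ^ (k + m) \<preceq> \<tau> * p"
      unfolding strongly_SOS_def by blast
    define \<rho> where "\<rho> = pconst (1 / \<delta>) * \<tau>"
    have "1 \<preceq> (usq :: 'n rpoly) ^ k" using usq_power_mono[of 0 k] by simp
    also have "(usq :: 'n rpoly) ^ k = pconst (1 / \<delta>) * (pconst \<delta> * usq ^ k)"
      using \<delta> by (simp add: mult.assoc[symmetric] pconst_mult[symmetric])
    also have "\<dots> \<preceq> \<rho>" unfolding \<rho>_def using \<delta> by (intro sos_le_mult_left SOS_pconst) auto
    finally have "\<rho> - 1 \<in> SOS" by (simp add: sos_le_def)
    define r where "r = \<rho> * pconst (C + z)"
    have "deg_le r (0 + 2 * k + 0)" unfolding r_def \<rho>_def by (intro deg_le_mult deg_le_pconst \<tau>)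
    then have "deg_le r (2 * (k + m') + 1)" by (rule deg_le_mono) simp
    moreover have "\<delta>' / \<delta> > 0" using \<delta>(1) \<delta>'(1) by simp
    moreover have "Suc (k + m') = k + m" using Suc by simp
    ultimately obtain C' where C': "r \<preceq> pconst (\<delta>' / \<delta>) * usq ^ (k + m) + pconst C'"
      using lower_degree_dominated[of r "k + m'" "\<delta>' / \<delta>"] by metis
    have "pconst (\<delta>' / \<delta>) * usq ^ (k + m) =
        pconst (1 / \<delta>) * (pconst \<delta>' * (usq :: 'n rpoly) ^ (k + m))"
      by (simp add: mult.assoc[symmetric] pconst_mult[symmetric])
    also have "\<dots> \<preceq> pconst (1 / \<delta>) * (\<tau> * p)" using \<delta>(1) \<delta>'(2) by (intro sos_le_mult_left SOS_pconst) auto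
    finally have "pconst (\<delta>' / \<delta>) * usq ^ (k + m) \<preceq> \<rho> * p" by (simp add: \<rho>_def mult.assoc)
    then have "r \<preceq> \<rho> * p + pconst C'"
      by (intro sos_le_trans[OF C'] sos_le_add sos_le_refl)
    then have "\<rho> * p + pconst C' - r \<in> SOS" by (simp add: sos_le_def)
    moreover have "f - pconst (z - C') - (\<rho> - 1) * (pconst z - f) = \<rho> * p + pconst C' - r"
      by (simp add: r_def p_def pconst_add pconst_diff algebra_simps)
    ultimately have "f - pconst (z - C') - (\<rho> - 1) * (pconst z - f) \<in> SOS" by simp
    with \<open>\<rho> - 1 \<in> SOS\<close> show ?thesis by blast
  qed
qed

section \<open>Underestimators and feasible points of (SLS)\<close>

lemma peval_shifted_even_poly:
  "peval (shifted_even_poly h J b) x =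
     (\<Sum>\<alpha>\<in>J. b \<alpha> * (\<Prod>j\<in>UNIV. (x $ j - h $ j) ^ (2 * Poly_Mapping.lookup \<alpha> j)))"
  by (simp add: shifted_even_poly_def shifted_even_monom_def)

lemma peval_round_vec: "peval (shifted_even_poly h J b) (round_vec h) = objective h J b"
  by (simp add: peval_shifted_even_poly objective_def weight_def mult.commute)

lemma weight_zero [simp]: "weight h 0 = 1"
  by (simp add: weight_def)

text \<open>
  Rounding minimizes each distance $|x_j - h_j|$ over the integers separately, hence every
  even monomial centred at $h$.  The constant term has no sign but cancels.
\<close>

lemma shifted_even_poly_round_vec_le:
  assumes x: "x \<in> int_points" and b: "\<And>\<alpha>. \<alpha> \<in> J \<Longrightarrow> \<alpha> \<noteq> 0 \<Longrightarrow> b \<alpha> \<ge> 0"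
  shows "peval (shifted_even_poly h J b) (round_vec h) \<le> peval (shifted_even_poly h J b) x"
  unfolding peval_shifted_even_poly
proof (rule sum_mono)
  fix \<alpha> assume "\<alpha> \<in> J"
  have "(\<Prod>j\<in>UNIV. (round_vec h $ j - h $ j) ^ (2 * Poly_Mapping.lookup \<alpha> j))
      \<le> (\<Prod>j\<in>UNIV. (x $ j - h $ j) ^ (2 * Poly_Mapping.lookup \<alpha> j))"
  proof (rule prod_mono)
    fix j
    obtain i where "x $ j = of_int i" using x by (auto simp: int_points_def Ints_def)
    then have "\<bar>round_vec h $ j - h $ j\<bar> \<le> \<bar>x $ j - h $ j\<bar>"
      using round_diff_minimal[of "h $ j" i] by (simp add: round_vec_def abs_minus_commute)
    then have "(round_vec h $ j - h $ j)\<^sup>2 \<le> (x $ j - h $ j)\<^sup>2" by (simp add: abs_le_square_iff)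
    then show "0 \<le> (round_vec h $ j - h $ j) ^ (2 * Poly_Mapping.lookup \<alpha> j) \<and>
        (round_vec h $ j - h $ j) ^ (2 * Poly_Mapping.lookup \<alpha> j) \<le> (x $ j - h $ j) ^ (2 * Poly_Mapping.lookup \<alpha> j)"
      by (simp add: power_mult power_mono)
  qed
  then show "b \<alpha> * (\<Prod>j\<in>UNIV. (round_vec h $ j - h $ j) ^ (2 * Poly_Mapping.lookup \<alpha> j))
      \<le> b \<alpha> * (\<Prod>j\<in>UNIV. (x $ j - h $ j) ^ (2 * Poly_Mapping.lookup \<alpha> j))"
    using b[OF \<open>\<alpha> \<in> J\<close>] by (cases "\<alpha> = 0") (auto intro: mult_left_mono)
qed

text \<open>
  At an integer point with value at most $z$ the constraint gives $g \le f$.  All other integer points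
  have larger values than $q$, which is one of the former.
\<close>

lemma sls_feasible_bound:
  assumes feas: "(b, \<sigma>) \<in> sls_feasible f h z J k"
    and q: "q \<in> int_points" "peval f q \<le> z" and x: "x \<in> int_points"
  shows "peval (shifted_even_poly h J b) (round_vec h) \<le> peval f x"
proof -
  let ?g = "shifted_even_poly h J b"
  have b: "b \<alpha> \<ge> 0" if "\<alpha> \<in> J" "\<alpha> \<noteq> 0" for \<alpha>
    using feas that by (auto simp: sls_feasible_def pconst_SOS_iff)
  have sub: "peval ?g (round_vec h) \<le> peval f y" if y: "y \<in> int_points" "peval f y \<le> z" for y
  proof -
    have "0 \<le> peval \<sigma> y * (z - peval f y)"
      using feas y by (auto simp: sls_feasible_def intro!: mult_nonneg_nonneg SOS_nonneg)
    moreover have "0 \<le> peval (f - ?g - \<sigma> * (pconst z - f)) y"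
      using feas by (intro SOS_nonneg) (auto simp: sls_feasible_def)
    ultimately have "peval ?g y \<le> peval f y" by simp
    with shifted_even_poly_round_vec_le[where b = b, OF y(1) b] show ?thesis by (rule order_trans)
  qed
  show ?thesis using sub[OF q] sub[OF x] q by linarith
qed

lemma shifted_even_poly_constant:
  assumes "finite J" "0 \<in> J"
  shows "shifted_even_poly h J (\<lambda>\<alpha>. if \<alpha> = 0 then c else 0) = pconst c"
    and "objective h J (\<lambda>\<alpha>. if \<alpha> = 0 then c else 0) = c"
proof -
  have "shifted_even_poly h J (\<lambda>\<alpha>. if \<alpha> = 0 then c else 0) =
      (\<Sum>\<alpha>\<in>J. if \<alpha> = 0 then pconst c * shifted_even_monom h 0 else 0)"
    unfolding shifted_even_poly_def by (intro sum.cong) auto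
  then show "shifted_even_poly h J (\<lambda>\<alpha>. if \<alpha> = 0 then c else 0) = pconst c"
    using assms by (simp add: shifted_even_monom_def)
  have "objective h J (\<lambda>\<alpha>. if \<alpha> = 0 then c else 0) = (\<Sum>\<alpha>\<in>J. if \<alpha> = 0 then c else 0)"
    unfolding objective_def by (intro sum.cong) auto
  then show "objective h J (\<lambda>\<alpha>. if \<alpha> = 0 then c else 0) = c"
    using assms by simp
qed

lemma constant_sls_feasible:
  assumes "finite J" "0 \<in> J" "\<sigma> \<in> SOS" "f - pconst c - \<sigma> * (pconst z - f) \<in> SOS" "pdeg \<sigma> \<le> k"
  shows "((\<lambda>\<alpha>. if \<alpha> = 0 then c else 0), \<sigma>) \<in> sls_feasible f h z J k"
  using assms by (auto simp: sls_feasible_def shifted_even_poly_constant)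

lemma sls_feasible_mono: "k \<le> l \<Longrightarrow> sls_feasible f h z J k \<subseteq> sls_feasible f h z J l"
  by (auto simp: sls_feasible_def)

lemma sls_value_mono: "k \<le> l \<Longrightarrow> sls_value f h z J k \<le> sls_value f h z J l"
  unfolding sls_value_def by (intro SUP_subset_mono sls_feasible_mono) auto

lemma sls_feasible_eventually:
  assumes "sls_feasible f h z J k \<noteq> {}"
  shows "\<exists>k0::nat. \<forall>k::nat. k \<ge> k0 \<longrightarrow> sls_feasible f h z J (ereal (real k)) \<noteq> {}"
proof -
  obtain b \<sigma> where b: "(b, \<sigma>) \<in> sls_feasible f h z J k" using assms by auto
  obtain k0 where "deg_le \<sigma> k0" using ex_deg_le by blast
  then have "(b, \<sigma>) \<in> sls_feasible f h z J (ereal (real k))" if "k \<ge> k0" for k :: nat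
    using b that deg_le_mono by (auto simp: sls_feasible_def pdeg_le_iff)
  then show ?thesis by blast
qed

lemma sls_feasible_MInf: "sls_feasible f h z J (-\<infinity>) = {(b, 0) | b. b \<in> glob_feasible f h J}"
  by (auto simp: sls_feasible_def glob_feasible_def pdeg_le_MInf_iff simp del: ereal_infty_less_eq)

theorem theorem15:
  fixes f :: "'n::finite rpoly" and h q :: "real ^ 'n" and z :: real and J :: "'n mindex set"
  assumes "finite J" and "q \<in> int_points" and "z \<ge> peval f q"
  shows
    "(\<forall>k. \<forall>g\<in>underestimators h. sls_feasible_solution f h z J k g \<longrightarrow>
        ereal (peval g (round_vec h)) \<le> (INF x\<in>int_points. ereal (peval f x)))
     \<and>
     (sls_value f h z J (-\<infinity>) \<le> sls_value f h z J 0 \<and>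
      (\<forall>m::nat. sls_value f h z J (ereal (real (2 * m)))
                 \<le> sls_value f h z J (ereal (real (2 * m + 2)))))
     \<and>
     (positive_definite (leading_form f) \<and>
      (0 \<in> J \<or> (\<exists>k. sls_feasible f h z J k \<noteq> {})) \<longrightarrow>
        (\<exists>k0::nat. \<forall>k::nat. k \<ge> k0 \<longrightarrow> sls_feasible f h z J (ereal (real k)) \<noteq> {}))
     \<and>
     (sls_feasible f h z J (-\<infinity>) = {(b, 0) | b. b \<in> glob_feasible f h J} \<and>
      sls_value f h z J (-\<infinity>) = glob_value f h J)
     \<and>
     (0 \<in> J \<and> f - pconst (peval f h) \<in> SOS \<longrightarrow>
        (\<forall>k. \<forall>g\<in>underestimators h. sls_optimal_solution f h z J k g \<longrightarrow>
           peval g (round_vec h) \<ge> peval f h))"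
proof (intro conjI impI allI ballI)
  fix k g assume "sls_feasible_solution f h z J k g"
  then obtain b \<sigma> where "(b, \<sigma>) \<in> sls_feasible f h z J k" "g = shifted_even_poly h J b"
    by (auto simp: sls_feasible_solution_def)
  then show "ereal (peval g (round_vec h)) \<le> (INF x\<in>int_points. ereal (peval f x))"
    using sls_feasible_bound assms by (intro INF_greatest) auto
next
  show "sls_value f h z J (-\<infinity>) \<le> sls_value f h z J 0" by (rule sls_value_mono) simp
  show "sls_value f h z J (ereal (real (2 * m))) \<le> sls_value f h z J (ereal (real (2 * m + 2)))" for m
    by (rule sls_value_mono) simp
next
  assume *: "positive_definite (leading_form f) \<and> (0 \<in> J \<or> (\<exists>k. sls_feasible f h z J k \<noteq> {}))"
  have "\<exists>k. sls_feasible f h z J k \<noteq> {}"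
  proof (cases "0 \<in> J")
    case True
    obtain b \<sigma> where "\<sigma> \<in> SOS" "f - pconst b - \<sigma> * (pconst z - f) \<in> SOS"
      using bounded_below_certificate * by blast
    then show ?thesis using constant_sls_feasible[OF \<open>finite J\<close> True] by blast
  qed (use * in blast)
  then show "\<exists>k0::nat. \<forall>k::nat. k \<ge> k0 \<longrightarrow> sls_feasible f h z J (ereal (real k)) \<noteq> {}"
    using sls_feasible_eventually by blast
next
  show "sls_feasible f h z J (-\<infinity>) = {(b, 0) | b. b \<in> glob_feasible f h J}"
    by (rule sls_feasible_MInf)
  have "{(b, 0) | b. b \<in> glob_feasible f h J} = (\<lambda>b. (b, 0 :: 'n rpoly)) ` glob_feasible f h J" by auto
  then show "sls_value f h z J (-\<infinity>) = glob_value f h J"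
    by (simp add: sls_value_def glob_value_def sls_feasible_MInf image_image)
next
  fix k g
  assume J: "0 \<in> J \<and> f - pconst (peval f h) \<in> SOS" and opt: "sls_optimal_solution f h z J k g"
  obtain b where "g = shifted_even_poly h J b"
    and max: "\<forall>(b', \<sigma>')\<in>sls_feasible f h z J k. objective h J b' \<le> objective h J b"
    using opt by (auto simp: sls_optimal_solution_def)
  moreover have "pdeg (0 :: 'n rpoly) \<le> k"
    using pdeg_le_MInf_iff[of "0 :: 'n rpoly"] by (metis ereal_less_eq(2) order_trans)
  then have "((\<lambda>\<alpha>. if \<alpha> = 0 then peval f h else 0), 0) \<in> sls_feasible f h z J k"
    using J \<open>finite J\<close> by (intro constant_sls_feasible) auto
  with max have "objective h J (\<lambda>\<alpha>. if \<alpha> = 0 then peval f h else 0) \<le> objective h J b" by blast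
  ultimately show "peval g (round_vec h) \<ge> peval f h"
    using J \<open>finite J\<close> by (simp add: shifted_even_poly_constant peval_round_vec)
qed

end
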